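(* Assume that the problem is exponentially ill-posed, i.e. $\sigma_j^2=e^{-aj}$ for all $j\in\mathbb{N}$, for some $a>0$. Let $\tau>1$ and let $k^\delta_{dp}$ be the truncation level determined by the modified discrepancy principle (defined in the context). Then, for the logarithmic source sets $\mathcal{X}_{p,\rho}$, $p,\rho>0$ (defined in the context), $$\sup_{\hat x\in\mathcal{X}_{p,\rho}}\mathbb{P}\left(\|x^\delta_{k^\delta_{dp}}-\hat x\|\le\rho\left(-\log\left(\frac{\delta^2}{\rho^2}\right)\right)^{-\frac p2}(1+o(1))\right)\to1\qquad\text{as }\delta/\rho\to0.$$
   Context: $\mathbb{N}=\{1,2,\dots\}$. $K:\mathcal{X}\to\mathcal{Y}$ is a compact linear operator with dense range between infinite-dimensional Hilbert spaces with singular value decomposition $(\sigma_j,u_j,v_j)_{j\in\mathbb{N}}$: $\sigma_1\ge\sigma_2\ge\dots>0$, $(u_j)$ and $(v_j)$ are orthonormal bases of $\mathcal{Y}$ and $\mathcal{N}(K)^\perp\subset\mathcal{X}$ respectively, $Kv_j=\sigma_ju_j$, $K^*u_j=\sigma_jv_j$. White noise: $Z$ is white noise, i.e. $\mathbb{E}[(Z,y)]=0$ and $\mathbb{E}[(Z,y)(Z,y')]=(y,y')$ for all $y,y'\in\mathcal{Y}$. For given $\hat x$ and noise level $\delta>0$, $\hat y=K\hat x$ and the data are $y^\delta=\hat y+\delta Z$, meaning $(y^\delta,u_j)=(\hat y,u_j)+\delta(Z,u_j)$ for all $j$. Spectral cut-off: $x_k^\delta:=\sum_{j=1}^k\frac{(y^\delta,u_j)}{\sigma_j}v_j$.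 Modified discrepancy principle: for fixed $\tau>1$ and $m\in\mathbb{N}$, $$k^\delta_{dp}(m):=\min\Big\{0\le k\le m:\ \sqrt{\textstyle\sum_{j=k+1}^m(y^\delta,u_j)^2}\le\tau\sqrt{m}\,\delta\Big\},\qquad k^\delta_{dp}:=\max_{m\in\mathbb{N}}k^\delta_{dp}(m).$$ Logarithmic source condition, for $p,\rho>0$: $\mathcal{X}_{p,\rho}:=\{(-\log(K^*K))^{-p/2}\xi:\ \xi\in\mathcal{X},\ \|\xi\|\le\rho\}$, i.e. the elements $\sum_{j=1}^\infty(-\log\sigma_j^2)^{-p/2}(\xi,v_j)v_j$ with $\|\xi\|\le\rho$. The symbol $o(1)$ denotes a term tending to $0$ as $\delta/\rho\to0$. *)

theory Defs
  imports "HOL-Probability.Probability"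
begin

text \<open>
  Hilbert spaces are the types of sort \<open>{real_inner, complete_space}\<close>.  Sequences are indexed by
  \<open>{1..}\<close> as in the text; their values at index \<open>0\<close> are irrelevant.
\<close>

definition compact_operator ::
    "('x::{real_inner,complete_space} \<Rightarrow> 'y::{real_inner,complete_space}) \<Rightarrow> bool" where
  "compact_operator K \<longleftrightarrow> linear K \<and> compact (closure (K ` cball 0 1))"

definition orthonormal_basis_of :: "(nat \<Rightarrow> 'x::{real_inner,complete_space}) \<Rightarrow> 'x set \<Rightarrow> bool" where
  "orthonormal_basis_of e V \<longleftrightarrow>
     (\<forall>i\<ge>1. \<forall>j\<ge>1. e i \<bullet> e j = (if i = j then 1 else 0)) \<and>
     closure (span (e ` {1..})) = V"

text \<open>Both spaces are infinite-dimensional as soon as such a system exists.\<close>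

definition singular_value_decomposition ::
    "('x::{real_inner,complete_space} \<Rightarrow> 'y::{real_inner,complete_space}) \<Rightarrow>
     (nat \<Rightarrow> real) \<Rightarrow> (nat \<Rightarrow> 'y) \<Rightarrow> (nat \<Rightarrow> 'x) \<Rightarrow> bool" where
  "singular_value_decomposition K \<sigma> u v \<longleftrightarrow>
     (\<forall>j\<ge>1. 0 < \<sigma> j) \<and> (\<forall>i\<ge>1. \<forall>j\<ge>i. \<sigma> j \<le> \<sigma> i) \<and>
     orthonormal_basis_of u UNIV \<and>
     orthonormal_basis_of v ({x. K x = 0}\<^sup>\<bottom>) \<and>
     (\<forall>j\<ge>1. K (v j) = \<sigma> j *\<^sub>R u j) \<and>
     (\<forall>j\<ge>1. adjoint K (u j) = \<sigma> j *\<^sub>R v j)"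

text \<open>
  White noise is a family of random variables \<open>Z y\<close>, written \<open>(Z, y)\<close> in the text; \<open>Z\<close> is not a
  random element of the Hilbert space.  Square integrability ensures that the expectations
  are genuine ones.
\<close>

definition white_noise :: "'w measure \<Rightarrow> ('y::{real_inner,complete_space} \<Rightarrow> 'w \<Rightarrow> real) \<Rightarrow> bool" where
  "white_noise M Z \<longleftrightarrow>
     (\<forall>y. Z y \<in> borel_measurable M \<and> integrable M (\<lambda>\<omega>. (Z y \<omega>)\<^sup>2)) \<and>
     (\<forall>y. (\<integral>\<omega>. Z y \<omega> \<partial>M) = 0) \<and>
     (\<forall>y y'. (\<integral>\<omega>. Z y \<omega> * Z y' \<omega> \<partial>M) = y \<bullet> y')"

definition iid_coefficients ::
    "'w measure \<Rightarrow> ('y \<Rightarrow> 'w \<Rightarrow> real) \<Rightarrow> (nat \<Rightarrow> 'y) \<Rightarrow> bool" where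
  "iid_coefficients M Z u \<longleftrightarrow>
     prob_space.indep_vars M (\<lambda>_. borel) (\<lambda>j. Z (u j)) {1..} \<and>
     (\<forall>j\<ge>1. distr M borel (Z (u j)) = distr M borel (Z (u 1)))"

text \<open>The generalised element \<open>K x + \<delta> Z\<close>, given by its action \<open>y \<mapsto> (K x + \<delta> Z, y)\<close>.\<close>

definition noisy_data ::
    "('x \<Rightarrow> 'y::{real_inner,complete_space}) \<Rightarrow> ('y \<Rightarrow> 'w \<Rightarrow> real) \<Rightarrow> real \<Rightarrow> 'x \<Rightarrow> 'w \<Rightarrow> 'y \<Rightarrow> real" where
  "noisy_data K Z \<delta> x \<omega> y = K x \<bullet> y + \<delta> * Z y \<omega>"

text \<open>In the following definitions \<open>d y\<close> stands for \<open>(y\<^sup>\<delta>, y)\<close>.\<close>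

definition spectral_cutoff ::
    "(nat \<Rightarrow> real) \<Rightarrow> (nat \<Rightarrow> 'y) \<Rightarrow> (nat \<Rightarrow> 'x::{real_inner,complete_space}) \<Rightarrow>
     ('y \<Rightarrow> real) \<Rightarrow> nat \<Rightarrow> 'x" where
  "spectral_cutoff \<sigma> u v d k = (\<Sum>j=1..k. (d (u j) / \<sigma> j) *\<^sub>R v j)"

definition k_dp_at :: "real \<Rightarrow> real \<Rightarrow> (nat \<Rightarrow> 'y) \<Rightarrow> ('y \<Rightarrow> real) \<Rightarrow> nat \<Rightarrow> nat" where
  "k_dp_at \<tau> \<delta> u d m =
     Min {k. k \<le> m \<and> sqrt (\<Sum>j=k+1..m. (d (u j))\<^sup>2) \<le> \<tau> * sqrt (real m) * \<delta>}"

text \<open>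
  If the levels \<open>k_dp_at \<tau> \<delta> u d m\<close> are unbounded in \<open>m\<close>, the maximum does not exist and \<open>Max\<close> is an
  unspecified natural number.  For i.i.d. noise coefficients and \<open>\<tau> > 1\<close> this happens with
  probability zero, by the strong law of large numbers.
\<close>

definition k_dp :: "real \<Rightarrow> real \<Rightarrow> (nat \<Rightarrow> 'y) \<Rightarrow> ('y \<Rightarrow> real) \<Rightarrow> nat" where
  "k_dp \<tau> \<delta> u d = Max (k_dp_at \<tau> \<delta> u d ` {1..})"

text \<open>
  The set of all \<open>(- log (K\<^sup>*K))\<^bsup>-p/2\<^esup> \<xi>\<close> with \<open>\<parallel>\<xi>\<parallel> \<le> \<rho>\<close>, through the singular system of \<open>K\<close>.
\<close>

definition log_source_set ::
    "(nat \<Rightarrow> real) \<Rightarrow> (nat \<Rightarrow> 'x::{real_inner,complete_space}) \<Rightarrow> real \<Rightarrow> real \<Rightarrow> 'x set" where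
  "log_source_set \<sigma> v p \<rho> =
     {x. \<exists>\<xi>. norm \<xi> \<le> \<rho> \<and>
        ((\<lambda>j. ((- ln ((\<sigma> j)\<^sup>2)) powr (- p / 2) * (\<xi> \<bullet> v j)) *\<^sub>R v j) has_sum x) {1..}}"

text \<open>The filter \<open>\<delta>/\<rho> \<rightarrow> 0\<close> on pairs \<open>(\<delta>, \<rho>)\<close> of positive reals, both allowed to vary.\<close>

definition noise_ratio_to_0 :: "(real \<times> real) filter" where
  "noise_ratio_to_0 =
     inf (filtercomap (\<lambda>(\<delta>, \<rho>). \<delta> / \<rho>) (at_right 0)) (principal ({0<..} \<times> {0<..}))"

text \<open>
  \<open>dp_success_prob M K \<sigma> u v Z \<tau> \<delta> B x\<close> is the probability that the error for the exact solution
  \<open>x\<close> is at most \<open>B\<close>.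
\<close>

definition dp_success_prob ::
    "'w measure \<Rightarrow> ('x::{real_inner,complete_space} \<Rightarrow> 'y::{real_inner,complete_space}) \<Rightarrow>
     (nat \<Rightarrow> real) \<Rightarrow> (nat \<Rightarrow> 'y) \<Rightarrow> (nat \<Rightarrow> 'x) \<Rightarrow> ('y \<Rightarrow> 'w \<Rightarrow> real) \<Rightarrow>
     real \<Rightarrow> real \<Rightarrow> real \<Rightarrow> 'x \<Rightarrow> real" where
  "dp_success_prob M K \<sigma> u v Z \<tau> \<delta> B x =
     measure M {\<omega> \<in> space M.
       norm (spectral_cutoff \<sigma> u v (noisy_data K Z \<delta> x \<omega>) (k_dp \<tau> \<delta> u (noisy_data K Z \<delta> x \<omega>)) - x)
         \<le> B}"

end

theory Submission
  imports Defs "HOL-Real_Asymp.Real_Asymp"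
begin

text \<open>
  Put \<open>s = - ln (\<delta>\<^sup>2 / \<rho>\<^sup>2)\<close>, so that \<open>\<delta>\<^sup>2 = \<rho>\<^sup>2 exp (- s)\<close>; the claimed error is
  \<open>\<rho> s\<^bsup>-p/2\<^esup> (1 + o(1))\<close>.  Since \<open>(v\<^sub>j)\<close> is orthonormal, the squared error at level \<open>k\<close> splits into
  the propagated noise \<open>\<delta>\<^sup>2 \<Sum>\<^bsub>j\<le>k\<^esub> exp (a j) (Z, u\<^sub>j)\<^sup>2\<close> and the squared bias
  \<open>\<Sum>\<^bsub>j>k\<^esub> (x, v\<^sub>j)\<^sup>2\<close>.  Exponential ill-posedness makes two truncation levels that differ only by a
  multiple of \<open>ln s\<close> interchangeable for the bias, while a factor \<open>s\<^sup>q\<close> is gained or lost in the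
  noise.  This leaves room for two deterministic levels
  \<open>l = (s - (p + 2) ln s) / a \<le> k = (s - (p + 1/2) ln s) / a\<close> with the following roles.

  \<^item> The chosen level does not exceed \<open>k\<close>: beyond \<open>k\<close> the signal has squared norm at most
  \<open>exp (- a k) (a k)\<^bsup>-p\<^esup> \<rho>\<^sup>2\<close>, which is of lower order than \<open>\<delta>\<^sup>2 k\<close>, and the squared noise
  norm on \<open>{1..m}\<close> is at most \<open>\<theta>\<^sup>2 m \<delta>\<^sup>2\<close> with \<open>\<theta> < \<tau>\<close>, for all large \<open>m\<close> at once.  The propagated
  noise up to \<open>k\<close> has expectation of order \<open>\<rho>\<^sup>2 s\<^bsup>-p-1/2\<^esup>\<close> and is negligible by Markov's inequality.

  \<^item> The bias is as small as at level \<open>l\<close>: the discrepancy inequality for \<open>m = l\<close> bounds the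
  signal between the chosen level and \<open>l\<close> in the image space by \<open>2 \<tau> \<delta> \<surd>l\<close>, and squaring and dividing by
  \<open>\<sigma>\<^sub>l\<^sup>2 = exp (- a l)\<close> gives a contribution of order \<open>\<rho>\<^sup>2 s\<^bsup>-p-1\<^esup>\<close>.  The rest of the bias is
  at most \<open>(a l)\<^bsup>-p\<^esup> \<rho>\<^sup>2\<close> by the source condition, and \<open>a l / s \<rightarrow> 1\<close>; this is the leading term.

  The two random events involve neither \<open>x\<close> nor \<open>\<rho>\<close> and \<open>\<delta>\<close> other than through \<open>s\<close>, which makes
  the estimate uniform over the source set (\<open>dp_success_prob_lower_bound\<close>).  The bound on the
  noise for all large \<open>m\<close> at once is the upper half of the strong law of large numbers for
  \<open>(Z, u\<^sub>j)\<^sup>2\<close>; it is derived from \<open>iid_negative_mean_walk_bounded\<close>: a random walk with negative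
  drift is almost surely bounded above, which Garsia's argument for the maximal ergodic theorem
  proves in a few lines.

  For the supremum it suffices to exhibit one good exact solution.  For the exact solution \<open>0\<close> the
  data are a multiple of the noise, the selected level does not depend on \<open>\<delta>\<close>, and the error is \<open>\<delta> W\<close> for a fixed finite random variable \<open>W\<close>; this holds even on the
  event where the levels are unbounded and \<open>k_dp\<close> takes its unspecified value.
\<close>

section \<open>Random walks with negative drift\<close>

text \<open>
  The maximum of \<open>0\<close> and the first \<open>n\<close> partial sums of \<open>w\<close>, by a recursion that peels off the
  first step.  In this form it interacts with the shift of the sequence, on which Garsia's
  argument rests.
\<close>
primrec running_max :: "nat \<Rightarrow> (nat \<Rightarrow> real) \<Rightarrow> real" where
  "running_max 0 w = 0"
| "running_max (Suc n) w = max 0 (w 0 + running_max n (\<lambda>i. w (Suc i)))"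

lemma running_max_nonneg: "0 \<le> running_max n w"
  by (cases n) auto

lemma partial_sum_le_running_max: "(\<Sum>i<n. w i) \<le> running_max n w"
proof (induction n arbitrary: w)
  case (Suc n)
  show ?case using Suc[of "\<lambda>i. w (Suc i)"]
    by (simp add: sum.lessThan_Suc_shift del: sum.lessThan_Suc)
qed simp

lemma running_max_mono: "running_max n w \<le> running_max (Suc n) w"
proof (induction n arbitrary: w)
  case (Suc n)
  show ?case using Suc[of "\<lambda>i. w (Suc i)"] by auto
qed simp

lemma running_max_le_abs_sum: "running_max n w \<le> (\<Sum>i<n. \<bar>w i\<bar>)"
proof (induction n arbitrary: w)
  case (Suc n)
  have "0 \<le> (\<Sum>i<n. \<bar>w (Suc i)\<bar>)" by (simp add: sum_nonneg)
  then show ?case using Suc[of "\<lambda>i. w (Suc i)"]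
    by (simp add: sum.lessThan_Suc_shift del: sum.lessThan_Suc)
qed simp

definition unbounded_walk :: "(nat \<Rightarrow> real) \<Rightarrow> bool" where
  "unbounded_walk w \<longleftrightarrow> (\<forall>C::nat. \<exists>n. real C < running_max n w)"

lemma unbounded_walk_shift: "unbounded_walk (\<lambda>i. w (Suc i)) \<longleftrightarrow> unbounded_walk w"
proof
  assume *: "unbounded_walk (\<lambda>i. w (Suc i))"
  show "unbounded_walk w"
    unfolding unbounded_walk_def
  proof
    fix C :: nat
    obtain n where "real (C + nat \<lceil>\<bar>w 0\<bar>\<rceil>) < running_max n (\<lambda>i. w (Suc i))"
      using * unfolding unbounded_walk_def by blast
    then have "real C < w 0 + running_max n (\<lambda>i. w (Suc i))" by linarith
    then show "\<exists>n. real C < running_max n w" by (intro exI[of _ "Suc n"]) auto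
  qed
next
  assume *: "unbounded_walk w"
  show "unbounded_walk (\<lambda>i. w (Suc i))"
    unfolding unbounded_walk_def
  proof
    fix C :: nat
    obtain n where n: "real (C + nat \<lceil>\<bar>w 0\<bar>\<rceil>) < running_max n w"
      using * unfolding unbounded_walk_def by blast
    then obtain m where m: "n = Suc m" by (cases n) (auto simp flip: of_nat_add)
    have "real C < running_max m (\<lambda>i. w (Suc i))" using n unfolding m running_max.simps by linarith
    then show "\<exists>n. real C < running_max n (\<lambda>i. w (Suc i))" by blast
  qed
qed

lemma running_max_measurable:
  assumes "sets D = sets borel"
  shows "running_max n \<in> borel_measurable (Pi\<^sub>M UNIV (\<lambda>_::nat. D))"
proof (induction n)
  case (Suc n)
  have co: "(\<lambda>w. w i) \<in> borel_measurable (Pi\<^sub>M UNIV (\<lambda>_::nat. D))" for i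
    using measurable_component_singleton[of i UNIV "\<lambda>_. D"] assms
    by (simp cong: measurable_cong_sets)
  have "(\<lambda>w i. w (Suc i)) \<in> measurable (Pi\<^sub>M UNIV (\<lambda>_::nat. D)) (Pi\<^sub>M UNIV (\<lambda>_. D))"
    by (rule measurable_PiM_single') (auto simp: space_PiM PiE_def)
  from measurable_compose[OF this Suc] co[of 0] show ?case by simp
qed simp

text \<open>
  Let \<open>I\<close> be the indicator of the shift-invariant event that the walk is unbounded and \<open>R\<^sub>n\<close> the
  running maximum.  By stationarity the expectations of \<open>I R\<^sub>n\<close> along the sequence and along its shift
  agree, so the monotonicity of \<open>R\<^sub>n\<close> in \<open>n\<close> shows that the increment
  \<open>I (R\<^sub>n\<^sub>+\<^sub>1 - R\<^sub>n \<circ> shift) = I max (- (R\<^sub>n \<circ> shift)) w\<^sub>0\<close> has nonnegative expectation.  On the event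
  it tends to \<open>w\<^sub>0\<close>, and the event is independent of \<open>w\<^sub>0\<close> because it depends on the shifted
  sequence alone.  Hence the mean of \<open>w\<^sub>0\<close> times the probability of the event is nonnegative.
\<close>
lemma iid_negative_mean_walk_bounded:
  fixes D :: "real measure"
  assumes "prob_space D" and sets_D: "sets D = sets borel"
    and int: "integrable D (\<lambda>x. x)" and neg: "(\<integral>x. x \<partial>D) < 0"
  shows "AE w in Pi\<^sub>M UNIV (\<lambda>_::nat. D). \<not> unbounded_walk w"
proof -
  interpret D: prob_space D by fact
  interpret sequence_space D by unfold_locales
  interpret DS: pair_sigma_finite D S by unfold_locales
  have co: "(\<lambda>w. w i) \<in> borel_measurable S" for i
    using measurable_component_singleton[of i UNIV "\<lambda>_. D"] sets_D
    by (simp cong: measurable_cong_sets)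
  have [measurable]: "running_max n \<in> borel_measurable S" for n
    by (rule running_max_measurable[OF sets_D])
  have sh[measurable]: "(\<lambda>w i. w (Suc i)) \<in> measurable S S"
    by (rule measurable_PiM_single') (auto simp: space_PiM PiE_def)
  have cn[measurable]: "(\<lambda>(x, w). case_nat x w) \<in> measurable (D \<Otimes>\<^sub>M S) S"
    unfolding split_beta' by measurable
  have gt: "Measurable.pred S (\<lambda>w. c < running_max n w)" for c n
    unfolding pred_def by (rule borel_measurable_less) auto
  have pU[measurable]: "Measurable.pred S unbounded_walk"
    unfolding unbounded_walk_def by (intro pred_intros_countable gt)
  \<comment> \<open>A sequence of independent steps is a first step followed by an independent copy of the
      sequence.\<close>
  have iter: "(\<integral>x. (\<integral>w. F (case_nat x w) \<partial>S) \<partial>D) = (\<integral>w. F w \<partial>S)"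
    if F: "integrable S F" for F :: "(nat \<Rightarrow> real) \<Rightarrow> real"
  proof -
    have [measurable]: "F \<in> borel_measurable S" using F by auto
    have "integrable (distr (D \<Otimes>\<^sub>M S) S (\<lambda>(x, w). case_nat x w)) F"
      using F by (simp add: PiM_iter)
    then have "integrable (D \<Otimes>\<^sub>M S) (\<lambda>z. F ((\<lambda>(x, w). case_nat x w) z))"
      by (subst (asm) integrable_distr_eq) auto
    then have "(\<integral>x. (\<integral>w. F (case_nat x w) \<partial>S) \<partial>D) = integral\<^sup>L (D \<Otimes>\<^sub>M S) (\<lambda>z. F ((\<lambda>(x, w). case_nat x w) z))"
      by (subst DS.integral_fst'[symmetric]) auto
    also have "\<dots> = integral\<^sup>L (distr (D \<Otimes>\<^sub>M S) S (\<lambda>(x, w). case_nat x w)) F"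
      by (subst integral_distr) auto
    finally show ?thesis by (simp add: PiM_iter)
  qed
  have comp: "integrable S (\<lambda>w. w i)" for i
  proof -
    have "distr S D (\<lambda>w. w i) = D" using PiM_component[of i] by simp
    then have "integrable (distr S D (\<lambda>w. w i)) (\<lambda>x. x)" using int by simp
    moreover have "(\<lambda>w. w i) \<in> measurable S D" by (rule measurable_component_singleton) simp
    ultimately show ?thesis
      using integrable_distr_eq[OF _ borel_measurable_integrable[OF int], of "\<lambda>w. w i" S] by simp
  qed
  define I where "I = (\<lambda>w. indicator {w. unbounded_walk w} w :: real)"
  have I01: "0 \<le> I w" "I w \<le> 1" for w by (auto simp: I_def indicator_def)
  have I_shift: "I (\<lambda>i. w (Suc i)) = I w" for w by (simp add: I_def unbounded_walk_shift indicator_def)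
  have I_cons: "I (case_nat x w) = I w" for x w using I_shift[of "case_nat x w"] by simp
  have [measurable]: "I \<in> borel_measurable S" unfolding I_def indicator_def by measurable
  let ?sh = "\<lambda>w i. w (Suc i)"
  have intR: "integrable S (\<lambda>w. I w * running_max n w)" for n
  proof (rule Bochner_Integration.integrable_bound)
    show "integrable S (\<lambda>w. \<Sum>i<n. \<bar>w i\<bar>)" using comp by auto
    have "I w * running_max n w \<le> (\<Sum>i<n. \<bar>w i\<bar>)" for w
      using mult_mono[OF I01(2)[of w] running_max_le_abs_sum[of n w]] running_max_nonneg[of n w] by simp
    then show "AE w in S. norm (I w * running_max n w) \<le> norm (\<Sum>i<n. \<bar>w i\<bar>)"
      by (auto simp: I01 running_max_nonneg sum_nonneg)
  qed auto
  have intRs: "integrable S (\<lambda>w. I w * running_max n (?sh w))" for n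
  proof (rule Bochner_Integration.integrable_bound)
    show "integrable S (\<lambda>w. \<Sum>i<n. \<bar>w (Suc i)\<bar>)" using comp by auto
    have "I w * running_max n (?sh w) \<le> (\<Sum>i<n. \<bar>?sh w i\<bar>)" for w
      using mult_mono[OF I01(2)[of w] running_max_le_abs_sum[of n "?sh w"]] running_max_nonneg[of n "?sh w"] by simp
    then show "AE w in S. norm (I w * running_max n (?sh w)) \<le> norm (\<Sum>i<n. \<bar>w (Suc i)\<bar>)"
      by (auto simp: I01 running_max_nonneg sum_nonneg)
  qed auto
  have intI: "integrable S (\<lambda>w. w 0 * I w)"
    using comp[of 0]
    by (rule Bochner_Integration.integrable_bound) (auto simp: I01 abs_mult intro!: borel_measurable_times[OF co] mult_right_le_one_le)
  \<comment> \<open>Stationarity: the invariant indicator is unaffected by the shift.\<close>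
  have stat: "(\<integral>w. I w * running_max n (?sh w) \<partial>S) = (\<integral>w. I w * running_max n w \<partial>S)" for n
    using iter[OF intRs[of n]] by (simp add: I_cons D.prob_space)
  define G where "G = (\<lambda>n w. I w * max (- running_max n (?sh w)) (w 0))"
  have Geq: "G n w = I w * running_max (Suc n) w - I w * running_max n (?sh w)" for n w
    by (auto simp: G_def max_def algebra_simps)
  have mG: "G n \<in> borel_measurable S" for n
    unfolding Geq by (intro borel_measurable_diff borel_measurable_integrable intR intRs)
  have Gnn: "0 \<le> (\<integral>w. G n w \<partial>S)" for n
  proof -
    have "(\<integral>w. I w * running_max n w \<partial>S) \<le> (\<integral>w. I w * running_max (Suc n) w \<partial>S)"
      by (intro integral_mono intR mult_left_mono running_max_mono I01)
    then show ?thesis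
      unfolding Geq by (subst Bochner_Integration.integral_diff[OF intR intRs]) (simp add: stat)
  qed
  have lim: "(\<lambda>n. \<integral>w. G n w \<partial>S) \<longlonglongrightarrow> (\<integral>w. w 0 * I w \<partial>S)"
  proof (rule integral_dominated_convergence)
    show "integrable S (\<lambda>w. \<bar>w 0\<bar>)" using comp by auto
    show "AE w in S. (\<lambda>n. G n w) \<longlonglongrightarrow> w 0 * I w"
    proof (rule AE_I2)
      fix w
      show "(\<lambda>n. G n w) \<longlonglongrightarrow> w 0 * I w"
      proof (cases "unbounded_walk w")
        case True
        then have "unbounded_walk (?sh w)" by (simp add: unbounded_walk_shift)
        then obtain N where N: "real (nat \<lceil>\<bar>w 0\<bar>\<rceil>) < running_max N (?sh w)"
          unfolding unbounded_walk_def by blast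
        have "G n w = w 0 * I w" if "n \<ge> N" for n
        proof -
          have "running_max N (?sh w) \<le> running_max n (?sh w)"
            using that running_max_mono by (rule lift_Suc_mono_le[rotated])
          with N have "- running_max n (?sh w) \<le> w 0" by linarith
          then show ?thesis by (simp add: G_def max_def)
        qed
        then show ?thesis by (intro tendsto_eventually) (auto simp: eventually_sequentially)
      qed (auto simp: G_def I_def)
    qed
    show "AE w in S. norm (G n w) \<le> \<bar>w 0\<bar>" for n
    proof (rule AE_I2)
      fix w
      have "\<bar>max (- running_max n (?sh w)) (w 0)\<bar> \<le> \<bar>w 0\<bar>"
        using running_max_nonneg[of n "?sh w"] by linarith
      then have "\<bar>I w\<bar> * \<bar>max (- running_max n (?sh w)) (w 0)\<bar> \<le> 1 * \<bar>w 0\<bar>"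
        using I01[of w] by (intro mult_mono) auto
      then show "norm (G n w) \<le> \<bar>w 0\<bar>" by (simp add: G_def abs_mult)
    qed
  qed (auto intro!: mG borel_measurable_times[OF co])
  have "0 \<le> (\<integral>w. w 0 * I w \<partial>S)" by (rule LIMSEQ_le_const[OF lim]) (use Gnn in auto)
  also have "\<dots> = (\<integral>x. x \<partial>D) * (\<integral>w. I w \<partial>S)"
    using iter[OF intI] by (simp add: I_cons)
  finally have "(\<integral>w. I w \<partial>S) \<le> 0" using neg by (auto simp: zero_le_mult_iff)
  moreover have "(\<integral>w. I w \<partial>S) = measure S {w \<in> space S. unbounded_walk w}"
  proof -
    have "(\<integral>w. I w \<partial>S) = (\<integral>w. indicator {w \<in> space S. unbounded_walk w} w \<partial>S)"
      by (intro Bochner_Integration.integral_cong) (auto simp: I_def indicator_def)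
    then show ?thesis by simp
  qed
  ultimately have "measure S {w \<in> space S. unbounded_walk w} = 0"
    using measure_nonneg[of S "{w \<in> space S. unbounded_walk w}"] by linarith
  moreover have "{w \<in> space S. unbounded_walk w} \<in> sets S" by measurable
  ultimately show ?thesis
    by (intro AE_I[of _ _ "{w \<in> space S. unbounded_walk w}"]) (auto simp: P.emeasure_eq_measure)
qed

text \<open>
  For \<open>c'\<close> strictly between the mean and \<open>c\<close> the walk with steps \<open>X\<^sub>i - c'\<close> has negative drift.
  An upper bound \<open>C\<close> for it is absorbed by \<open>(c - c') m\<close> as soon as \<open>m \<ge> C / (c - c')\<close>.
\<close>
lemma (in prob_space) iid_partial_sums_eventually_le:
  fixes X :: "nat \<Rightarrow> 'a \<Rightarrow> real"
  assumes ind: "indep_vars (\<lambda>_. borel) X UNIV"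
    and id: "\<And>i. distr M borel (X i) = distr M borel (X 0)"
    and int: "integrable M (X 0)" and c: "expectation (X 0) < c"
  shows "AE \<omega> in M. eventually (\<lambda>m. (\<Sum>i<m. X i \<omega>) \<le> c * real m) sequentially"
proof -
  obtain c' where c': "expectation (X 0) < c'" "c' < c" using dense[OF c] by blast
  have [measurable]: "X i \<in> borel_measurable M" for i
    using ind by (auto simp: indep_vars_def)
  define Y where "Y = (\<lambda>i \<omega>. X i \<omega> - c')"
  have [measurable]: "Y i \<in> borel_measurable M" for i unfolding Y_def by measurable
  have indY: "indep_vars (\<lambda>_. borel) Y UNIV"
    unfolding Y_def using indep_vars_compose2[OF ind, of "\<lambda>_ x. x - c'" "\<lambda>_. borel"] by simp
  define D where "D = distr M borel (Y 0)"
  have DY: "distr M borel (Y i) = D" for i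
  proof -
    have "distr M borel (Y i) = distr (distr M borel (X i)) borel (\<lambda>x. x - c')" for i
      unfolding Y_def by (subst distr_distr) (auto simp: comp_def)
    then show ?thesis unfolding D_def using id by metis
  qed
  have D: "prob_space D" unfolding D_def by (rule prob_space_distr) simp
  have seq: "distr M (Pi\<^sub>M UNIV (\<lambda>_. borel)) (\<lambda>\<omega> i. Y i \<omega>) = Pi\<^sub>M UNIV (\<lambda>_. D)"
    using indY indep_vars_iff_distr_eq_PiM'[of UNIV Y "\<lambda>_. borel"] by (simp add: DY restrict_UNIV)
  have Ym: "(\<lambda>\<omega> i. Y i \<omega>) \<in> measurable M (Pi\<^sub>M UNIV (\<lambda>_. borel))"
    by (rule measurable_PiM_single') (auto simp: space_PiM PiE_def)
  have "AE w in Pi\<^sub>M UNIV (\<lambda>_::nat. D). \<not> unbounded_walk w"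
  proof (rule iid_negative_mean_walk_bounded[OF D])
    show "sets D = sets borel" by (simp add: D_def)
    show "integrable D (\<lambda>x. x)" unfolding D_def
      using int by (subst integrable_distr_eq) (auto simp: Y_def)
    show "(\<integral>x. x \<partial>D) < 0" unfolding D_def
      using int c' by (subst integral_distr) (auto simp: Y_def prob_space)
  qed
  then have "AE \<omega> in M. \<not> unbounded_walk (\<lambda>i. Y i \<omega>)"
    unfolding seq[symmetric] by (rule AE_distrD[OF Ym])
  then show ?thesis
  proof eventually_elim
    case (elim \<omega>)
    then obtain C :: nat where C: "running_max n (\<lambda>i. Y i \<omega>) \<le> real C" for n
      unfolding unbounded_walk_def by (auto simp: not_less)
    have "(\<Sum>i<m. X i \<omega>) \<le> c * real m" if m: "m \<ge> nat \<lceil>real C / (c - c')\<rceil>" for m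
    proof -
      have "(\<Sum>i<m. X i \<omega>) - c' * real m \<le> real C"
        using order_trans[OF partial_sum_le_running_max C, of m]
        by (simp add: Y_def sum_subtractf mult.commute)
      moreover have "real C / (c - c') \<le> real m" using m by linarith
      then have "real C \<le> (c - c') * real m" using c' by (simp add: field_simps)
      ultimately show ?thesis by (simp add: algebra_simps)
    qed
    then show ?case unfolding eventually_sequentially by blast
  qed
qed

lemma (in prob_space) indep_vars_shift:
  assumes "indep_vars (\<lambda>_. N) X {1..}"
  shows "indep_vars (\<lambda>_. N) (\<lambda>i. X (Suc i)) UNIV"
proof -
  let ?F = "\<lambda>i. {X i -` A \<inter> space M |A. A \<in> sets N}"
  have ind: "indep_sets ?F {1..}" and rv: "\<And>i. i \<ge> 1 \<Longrightarrow> X i \<in> measurable M N"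
    using assms by (auto simp: indep_vars_def2)
  have "indep_sets (\<lambda>i. ?F (Suc i)) UNIV"
  proof (rule indep_setsI)
    show "?F (Suc i) \<subseteq> events" for i using rv[of "Suc i"] by (auto intro: measurable_sets)
    fix A :: "nat \<Rightarrow> 'a set" and J :: "nat set"
    assume J: "J \<noteq> {}" "finite J" and A: "\<forall>j\<in>J. A j \<in> ?F (Suc j)"
    have "prob (\<Inter>j\<in>Suc ` J. A (j - 1)) = (\<Prod>j\<in>Suc ` J. prob (A (j - 1)))"
      by (rule indep_setsD[OF ind]) (use J A in auto)
    then show "prob (\<Inter>j\<in>J. A j) = (\<Prod>j\<in>J. prob (A j))"
      by (simp add: prod.reindex image_image)
  qed
  with rv show ?thesis by (auto simp: indep_vars_def2)
qed

text \<open>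
  The events increase with \<open>n\<close>, and their union is almost sure by
  \<open>iid_partial_sums_eventually_le\<close>; continuity of the measure turns this into convergence of probabilities.
\<close>
lemma (in prob_space) iid_noise_tail_bound:
  fixes \<zeta> :: "nat \<Rightarrow> 'a \<Rightarrow> real"
  assumes ind: "indep_vars (\<lambda>_. borel) \<zeta> {1..}"
    and id: "\<And>j. j \<ge> 1 \<Longrightarrow> distr M borel (\<zeta> j) = distr M borel (\<zeta> 1)"
    and int: "integrable M (\<lambda>\<omega>. (\<zeta> 1 \<omega>)\<^sup>2)" and E: "expectation (\<lambda>\<omega>. (\<zeta> 1 \<omega>)\<^sup>2) = 1" and c: "1 < c"
  shows "(\<lambda>n. prob {\<omega> \<in> space M. \<forall>m\<ge>n. (\<Sum>j=1..m. (\<zeta> j \<omega>)\<^sup>2) \<le> c * real m}) \<longlonglongrightarrow> 1"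
proof -
  have zm: "\<zeta> j \<in> borel_measurable M" if "j \<ge> 1" for j
    using ind that by (auto simp: indep_vars_def)
  define X where "X = (\<lambda>i \<omega>. (\<zeta> (Suc i) \<omega>)\<^sup>2)"
  have Xm[measurable]: "X i \<in> borel_measurable M" for i unfolding X_def using zm by simp
  have "indep_vars (\<lambda>_. borel) (\<lambda>i. \<zeta> (Suc i)) UNIV"
    using ind by (rule indep_vars_shift)
  then have "indep_vars (\<lambda>_. borel) X UNIV"
    unfolding X_def by (rule indep_vars_compose2) auto
  moreover have "distr M borel (X i) = distr M borel (X 0)" for i
  proof -
    have "distr M borel (X i) = distr (distr M borel (\<zeta> (Suc i))) borel (\<lambda>x. x\<^sup>2)" for i
      unfolding X_def by (subst distr_distr) (auto simp: comp_def zm)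
    then show ?thesis using id[of "Suc i"] by simp
  qed
  ultimately have ae: "AE \<omega> in M. eventually (\<lambda>m. (\<Sum>i<m. X i \<omega>) \<le> c * real m) sequentially"
    using int E c by (intro iid_partial_sums_eventually_le) (auto simp: X_def)
  have sumX: "(\<Sum>j=1..m. (\<zeta> j \<omega>)\<^sup>2) = (\<Sum>i<m. X i \<omega>)" for m \<omega>
    unfolding X_def by (simp add: sum.atLeast1_atMost_eq)
  define B where "B n = {\<omega> \<in> space M. \<forall>m\<ge>n. (\<Sum>i<m. X i \<omega>) \<le> c * real m}" for n
  have Bm: "B n \<in> sets M" for n unfolding B_def by measurable
  have "(\<lambda>n. prob (B n)) \<longlonglongrightarrow> prob (\<Union>n. B n)"
    using Bm by (intro finite_Lim_measure_incseq) (auto simp: incseq_def B_def)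
  moreover have "prob (\<Union>n. B n) = 1"
  proof (rule prob_eq_1[THEN iffD2])
    show "AE \<omega> in M. \<omega> \<in> (\<Union>n. B n)"
      using ae AE_space by eventually_elim (auto simp: B_def eventually_sequentially)
  qed (use Bm in auto)
  ultimately show ?thesis unfolding B_def sumX by simp
qed

section \<open>The discrepancy principle\<close>

lemma k_dp_at_in:
  fixes d :: "'y \<Rightarrow> real"
  assumes "\<tau> > 0" "\<delta> > 0"
  shows "k_dp_at \<tau> \<delta> u d m \<le> m"
    and "sqrt (\<Sum>j=k_dp_at \<tau> \<delta> u d m + 1..m. (d (u j))\<^sup>2) \<le> \<tau> * sqrt (real m) * \<delta>"
proof -
  let ?A = "{k. k \<le> m \<and> sqrt (\<Sum>j=k+1..m. (d (u j))\<^sup>2) \<le> \<tau> * sqrt (real m) * \<delta>}"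
  have "finite ?A" by (rule finite_subset[of _ "{..m}"]) auto
  moreover have "m \<in> ?A" using assms by auto
  ultimately have "Min ?A \<in> ?A" by (intro Min_in) auto
  then show "k_dp_at \<tau> \<delta> u d m \<le> m"
    and "sqrt (\<Sum>j=k_dp_at \<tau> \<delta> u d m + 1..m. (d (u j))\<^sup>2) \<le> \<tau> * sqrt (real m) * \<delta>"
    unfolding k_dp_at_def by auto
qed

text \<open>
  If the residual beyond \<open>k\<close> passes the test for every \<open>m\<close>, the maximum defining \<open>k_dp\<close> ranges over
  a finite set, and the chosen level inherits every discrepancy inequality because residuals
  decrease in the truncation level.
\<close>
lemma k_dp_bounded:
  fixes d :: "'y \<Rightarrow> real"
  assumes pos: "\<tau> > 0" "\<delta> > 0"
    and k: "\<And>m. m > k \<Longrightarrow> sqrt (\<Sum>j=k+1..m. (d (u j))\<^sup>2) \<le> \<tau> * sqrt (real m) * \<delta>"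
  shows "k_dp \<tau> \<delta> u d \<le> k"
    and "m \<ge> 1 \<Longrightarrow> sqrt (\<Sum>j=k_dp \<tau> \<delta> u d + 1..m. (d (u j))\<^sup>2) \<le> \<tau> * sqrt (real m) * \<delta>"
proof -
  have le: "k_dp_at \<tau> \<delta> u d m \<le> k" for m
  proof (cases "m > k")
    case True
    have "finite {k. k \<le> m \<and> sqrt (\<Sum>j=k+1..m. (d (u j))\<^sup>2) \<le> \<tau> * sqrt (real m) * \<delta>}"
      by (rule finite_subset[of _ "{..m}"]) auto
    then show ?thesis unfolding k_dp_at_def using True k[OF True] by (intro Min_le) auto
  next
    case False
    then show ?thesis using k_dp_at_in(1)[OF pos, where u=u and d=d and m=m] by linarith
  qed
  have fin: "finite (k_dp_at \<tau> \<delta> u d ` {1..})"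
    by (rule finite_subset[of _ "{..k}"]) (use le in auto)
  then have "k_dp \<tau> \<delta> u d \<in> k_dp_at \<tau> \<delta> u d ` {1..}"
    unfolding k_dp_def by (intro Max_in) auto
  then show "k_dp \<tau> \<delta> u d \<le> k" using le by auto
  assume m: "m \<ge> 1"
  have "k_dp_at \<tau> \<delta> u d m \<le> k_dp \<tau> \<delta> u d"
    unfolding k_dp_def using fin m by (intro Max_ge) auto
  then have "(\<Sum>j=k_dp \<tau> \<delta> u d + 1..m. (d (u j))\<^sup>2) \<le> (\<Sum>j=k_dp_at \<tau> \<delta> u d m + 1..m. (d (u j))\<^sup>2)"
    by (intro sum_mono2) auto
  then show "sqrt (\<Sum>j=k_dp \<tau> \<delta> u d + 1..m. (d (u j))\<^sup>2) \<le> \<tau> * sqrt (real m) * \<delta>"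
    using k_dp_at_in(2)[OF pos, where u=u and d=d and m=m] by (meson order_trans real_sqrt_le_mono)
qed

section \<open>Orthonormal expansions and the source condition\<close>

lemma norm_sq_orthonormal_sum:
  fixes v :: "nat \<Rightarrow> 'x::real_inner"
  assumes on: "\<forall>i\<ge>1. \<forall>j\<ge>1. v i \<bullet> v j = (if i = j then 1 else 0)"
    and F: "finite F" "F \<subseteq> {1..}"
  shows "(norm (\<Sum>j\<in>F. c j *\<^sub>R v j))\<^sup>2 = (\<Sum>j\<in>F. (c j)\<^sup>2)"
proof -
  have "(\<Sum>i\<in>F. \<Sum>j\<in>F. c i * (c j * (v i \<bullet> v j))) = (\<Sum>i\<in>F. (c i)\<^sup>2)"
  proof (rule sum.cong[OF refl])
    fix i assume i: "i \<in> F"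
    have "(\<Sum>j\<in>F. c i * (c j * (v i \<bullet> v j))) = (\<Sum>j\<in>F. if j = i then (c i)\<^sup>2 else 0)"
      using on i F by (intro sum.cong refl) (auto simp: power2_eq_square subset_eq)
    then show "(\<Sum>j\<in>F. c i * (c j * (v i \<bullet> v j))) = (c i)\<^sup>2" using i F by simp
  qed
  then show ?thesis
    by (subst power2_norm_eq_inner, subst inner_sum_left, subst inner_sum_right)
      (simp add: mult.left_commute)
qed

text \<open>
  The decomposition of a squared error into the error of the coefficients and the tail of \<open>x\<close>.
  The tail is written as the difference between the squared norm and a finite sum, which is the
  form that is measurable and monotone in the truncation level at sight.
\<close>
lemma norm_sq_sum_minus:
  fixes v :: "nat \<Rightarrow> 'x::real_inner"
  assumes on: "\<forall>i\<ge>1. \<forall>j\<ge>1. v i \<bullet> v j = (if i = j then 1 else 0)"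
    and F: "finite F" "F \<subseteq> {1..}"
  shows "(norm ((\<Sum>j\<in>F. c j *\<^sub>R v j) - x))\<^sup>2
    = (\<Sum>j\<in>F. (c j - x \<bullet> v j)\<^sup>2) + ((norm x)\<^sup>2 - (\<Sum>j\<in>F. (x \<bullet> v j)\<^sup>2))"
proof -
  have "(norm ((\<Sum>j\<in>F. c j *\<^sub>R v j) - x))\<^sup>2
      = (norm (\<Sum>j\<in>F. c j *\<^sub>R v j))\<^sup>2 - 2 * ((\<Sum>j\<in>F. c j *\<^sub>R v j) \<bullet> x) + (norm x)\<^sup>2"
    by (simp add: power2_norm_eq_inner inner_diff_left inner_diff_right inner_commute)
  also have "(\<Sum>j\<in>F. c j *\<^sub>R v j) \<bullet> x = (\<Sum>j\<in>F. c j * (x \<bullet> v j))"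
    unfolding inner_sum_left by (simp add: inner_commute)
  finally show ?thesis
    unfolding norm_sq_orthonormal_sum[OF on F]
    by (simp add: power2_diff sum.distrib sum_subtractf sum_distrib_left algebra_simps)
qed

lemma bessel_inequality:
  fixes v :: "nat \<Rightarrow> 'x::real_inner"
  assumes on: "\<forall>i\<ge>1. \<forall>j\<ge>1. v i \<bullet> v j = (if i = j then 1 else 0)"
    and F: "finite F" "F \<subseteq> {1..}"
  shows "(\<Sum>j\<in>F. (x \<bullet> v j)\<^sup>2) \<le> (norm x)\<^sup>2"
  using norm_sq_sum_minus[OF on F, of "\<lambda>j. x \<bullet> v j" x]
    zero_le_power2[of "norm ((\<Sum>j\<in>F. (x \<bullet> v j) *\<^sub>R v j) - x)"] by simp

lemma has_sum_single:
  fixes f :: "nat \<Rightarrow> real"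
  assumes "(f has_sum s) A" "i \<in> A" "\<And>j. j \<in> A \<Longrightarrow> j \<noteq> i \<Longrightarrow> f j = 0"
  shows "s = f i"
proof -
  have "(f has_sum f i) A" by (rule has_sum_finite_neutralI[of "{i}"]) (use assms in auto)
  with assms(1) show ?thesis by (rule has_sum_unique)
qed

lemma compact_operator_bounded_linear:
  assumes "compact_operator K" shows "bounded_linear K"
proof -
  have lin: "linear K" and "compact (closure (K ` cball 0 1))"
    using assms unfolding compact_operator_def by blast+
  from compact_imp_bounded[OF this(2)] have "bounded (K ` cball 0 1)"
    by (rule bounded_subset) (rule closure_subset)
  then obtain B where B: "\<And>x. norm x \<le> 1 \<Longrightarrow> norm (K x) \<le> B"
    unfolding bounded_iff by (metis image_eqI mem_cball_0)
  interpret linear K by (rule lin)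
  show ?thesis
  proof (unfold_locales, intro exI[of _ B] allI)
    fix x
    show "norm (K x) \<le> norm x * B"
    proof (cases "x = 0")
      case False
      then have "norm (K ((1 / norm x) *\<^sub>R x)) \<le> B" by (intro B) simp
      then show ?thesis using False by (simp add: scale field_simps)
    qed (simp add: zero)
  qed
qed

text \<open>
  Orthonormality leaves only the \<open>i\<close>-th term of the defining series in the inner product with
  \<open>v\<^sub>i\<close>, which identifies that series with the Fourier series of \<open>x\<close>.
\<close>
lemma log_source_coefficients:
  fixes v :: "nat \<Rightarrow> 'x::{real_inner,complete_space}"
  assumes on: "\<forall>i\<ge>1. \<forall>j\<ge>1. v i \<bullet> v j = (if i = j then 1 else 0)"
    and \<sigma>: "\<forall>j\<ge>1. (\<sigma> j)\<^sup>2 = exp (- a * real j)"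
    and x: "x \<in> log_source_set \<sigma> v p \<rho>"
  obtains \<xi> where "norm \<xi> \<le> \<rho>" "\<And>j. j \<ge> 1 \<Longrightarrow> x \<bullet> v j = (a * real j) powr (- p / 2) * (\<xi> \<bullet> v j)"
    "((\<lambda>j. (x \<bullet> v j) *\<^sub>R v j) has_sum x) {1..}"
proof -
  obtain \<xi> where n: "norm \<xi> \<le> \<rho>"
    and hs: "((\<lambda>j. ((- ln ((\<sigma> j)\<^sup>2)) powr (- p / 2) * (\<xi> \<bullet> v j)) *\<^sub>R v j) has_sum x) {1..}"
    using x unfolding log_source_set_def by blast
  let ?g = "\<lambda>j. (a * real j) powr (- p / 2) * (\<xi> \<bullet> v j)"
  have hs: "((\<lambda>j. ?g j *\<^sub>R v j) has_sum x) {1..}"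
    using hs by (rule has_sum_cong[THEN iffD1, rotated]) (use \<sigma> in auto)
  have co: "x \<bullet> v i = ?g i" if "i \<ge> 1" for i
  proof -
    have "((\<lambda>j. (?g j *\<^sub>R v j) \<bullet> v i) has_sum (x \<bullet> v i)) {1..}"
      using has_sum_bounded_linear[OF bounded_linear_inner_left hs] by (simp add: comp_def)
    from has_sum_single[OF this, of i] show ?thesis using on that by auto
  qed
  have "((\<lambda>j. (x \<bullet> v j) *\<^sub>R v j) has_sum x) {1..}"
    using hs by (rule has_sum_cong[THEN iffD1, rotated]) (use co in auto)
  with n co show ?thesis by (intro that) auto
qed

text \<open>
  The weights \<open>(a j)\<^bsup>-p\<^esup>\<close> decrease in \<open>j\<close>, so beyond \<open>k\<close> the weight at \<open>k\<close> can be pulled out and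
  Bessel's inequality applies to the source element.  The second estimate is the limit of the
  first over finite partial sums of the Fourier series.
\<close>
lemma log_source_tail:
  fixes v :: "nat \<Rightarrow> 'x::{real_inner,complete_space}"
  assumes on: "\<forall>i\<ge>1. \<forall>j\<ge>1. v i \<bullet> v j = (if i = j then 1 else 0)"
    and \<sigma>: "\<forall>j\<ge>1. (\<sigma> j)\<^sup>2 = exp (- a * real j)" and pos: "a > 0" "p > 0" "k \<ge> 1"
    and x: "x \<in> log_source_set \<sigma> v p \<rho>"
  shows "finite F \<Longrightarrow> F \<subseteq> {k<..} \<Longrightarrow> (\<Sum>j\<in>F. (x \<bullet> v j)\<^sup>2) \<le> (a * real k) powr (- p) * \<rho>\<^sup>2"
    and "(norm x)\<^sup>2 - (\<Sum>j=1..k. (x \<bullet> v j)\<^sup>2) \<le> (a * real k) powr (- p) * \<rho>\<^sup>2"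
proof -
  obtain \<xi> where n: "norm \<xi> \<le> \<rho>"
    and co: "\<And>j. j \<ge> 1 \<Longrightarrow> x \<bullet> v j = (a * real j) powr (- p / 2) * (\<xi> \<bullet> v j)"
    and hs: "((\<lambda>j. (x \<bullet> v j) *\<^sub>R v j) has_sum x) {1..}"
    using log_source_coefficients[OF on \<sigma> x] by blast
  have tail: "(\<Sum>j\<in>F. (x \<bullet> v j)\<^sup>2) \<le> (a * real k) powr (- p) * \<rho>\<^sup>2"
    if F: "finite F" "F \<subseteq> {k<..}" for F
  proof -
    have "(\<Sum>j\<in>F. (x \<bullet> v j)\<^sup>2) \<le> (\<Sum>j\<in>F. (a * real k) powr (- p) * (\<xi> \<bullet> v j)\<^sup>2)"
    proof (rule sum_mono)
      fix j assume "j \<in> F"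
      then have j: "j > k" using F by auto
      have "(x \<bullet> v j)\<^sup>2 = (a * real j) powr (- p) * (\<xi> \<bullet> v j)\<^sup>2"
        using j pos by (simp add: co power_mult_distrib powr_power)
      also have "\<dots> \<le> (a * real k) powr (- p) * (\<xi> \<bullet> v j)\<^sup>2"
        using j pos by (intro mult_right_mono powr_mono2') auto
      finally show "(x \<bullet> v j)\<^sup>2 \<le> (a * real k) powr (- p) * (\<xi> \<bullet> v j)\<^sup>2" .
    qed
    also have "\<dots> = (a * real k) powr (- p) * (\<Sum>j\<in>F. (\<xi> \<bullet> v j)\<^sup>2)"
      by (simp add: sum_distrib_left)
    also have "\<dots> \<le> (a * real k) powr (- p) * \<rho>\<^sup>2"
    proof (rule mult_left_mono)
      have "F \<subseteq> {1..}" using F by force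
      from bessel_inequality[OF on F(1) this, of \<xi>] have "(\<Sum>j\<in>F. (\<xi> \<bullet> v j)\<^sup>2) \<le> (norm \<xi>)\<^sup>2" .
      also have "\<dots> \<le> \<rho>\<^sup>2" using n by (intro power_mono) auto
      finally show "(\<Sum>j\<in>F. (\<xi> \<bullet> v j)\<^sup>2) \<le> \<rho>\<^sup>2" .
    qed simp
    finally show ?thesis .
  qed
  show "finite F \<Longrightarrow> F \<subseteq> {k<..} \<Longrightarrow> (\<Sum>j\<in>F. (x \<bullet> v j)\<^sup>2) \<le> (a * real k) powr (- p) * \<rho>\<^sup>2"
    by (rule tail)
  have "((\<lambda>F. (norm (\<Sum>j\<in>F. (x \<bullet> v j) *\<^sub>R v j))\<^sup>2) \<longlongrightarrow> (norm x)\<^sup>2) (finite_subsets_at_top {1..})"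
    using hs unfolding has_sum_def by (intro tendsto_intros)
  moreover have "\<forall>\<^sub>F F in finite_subsets_at_top {1..}.
      (norm (\<Sum>j\<in>F. (x \<bullet> v j) *\<^sub>R v j))\<^sup>2 \<le> (\<Sum>j=1..k. (x \<bullet> v j)\<^sup>2) + (a * real k) powr (- p) * \<rho>\<^sup>2"
  proof (rule eventually_finite_subsets_at_top_weakI)
    fix F :: "nat set" assume F: "finite F" "F \<subseteq> {1..}"
    have "(norm (\<Sum>j\<in>F. (x \<bullet> v j) *\<^sub>R v j))\<^sup>2 = (\<Sum>j\<in>F. (x \<bullet> v j)\<^sup>2)"
      by (rule norm_sq_orthonormal_sum[OF on F])
    also have "\<dots> \<le> (\<Sum>j\<in>{1..k} \<union> (F \<inter> {k<..}). (x \<bullet> v j)\<^sup>2)"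
      using F by (intro sum_mono2) (auto simp: subset_eq)
    also have "\<dots> = (\<Sum>j=1..k. (x \<bullet> v j)\<^sup>2) + (\<Sum>j\<in>F \<inter> {k<..}. (x \<bullet> v j)\<^sup>2)"
      using F by (intro sum.union_disjoint) auto
    finally show "(norm (\<Sum>j\<in>F. (x \<bullet> v j) *\<^sub>R v j))\<^sup>2 \<le> (\<Sum>j=1..k. (x \<bullet> v j)\<^sup>2) + (a * real k) powr (- p) * \<rho>\<^sup>2"
      using tail[of "F \<inter> {k<..}"] F by auto
  qed
  ultimately have "(norm x)\<^sup>2 \<le> (\<Sum>j=1..k. (x \<bullet> v j)\<^sup>2) + (a * real k) powr (- p) * \<rho>\<^sup>2"
    by (rule tendsto_upperbound) simp
  then show "(norm x)\<^sup>2 - (\<Sum>j=1..k. (x \<bullet> v j)\<^sup>2) \<le> (a * real k) powr (- p) * \<rho>\<^sup>2" by simp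
qed

text \<open>
  Boundedness of \<open>K\<close> allows it to be applied to the series of \<open>x\<close> term by term.
\<close>
lemma log_source_image_coefficient:
  fixes v :: "nat \<Rightarrow> 'x::{real_inner,complete_space}"
  assumes K: "compact_operator K" and svd: "singular_value_decomposition K \<sigma> u v"
    and \<sigma>: "\<forall>j\<ge>1. (\<sigma> j)\<^sup>2 = exp (- a * real j)"
    and x: "x \<in> log_source_set \<sigma> v p \<rho>" and i: "i \<ge> 1"
  shows "K x \<bullet> u i = \<sigma> i * (x \<bullet> v i)"
proof -
  interpret K: bounded_linear K by (rule compact_operator_bounded_linear[OF K])
  have onv: "\<forall>i\<ge>1. \<forall>j\<ge>1. v i \<bullet> v j = (if i = j then 1 else 0)"
    and onu: "\<forall>i\<ge>1. \<forall>j\<ge>1. u i \<bullet> u j = (if i = j then 1 else 0)"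
    and Kv: "\<forall>j\<ge>1. K (v j) = \<sigma> j *\<^sub>R u j"
    using svd unfolding singular_value_decomposition_def orthonormal_basis_of_def by auto
  obtain \<xi> where hs: "((\<lambda>j. (x \<bullet> v j) *\<^sub>R v j) has_sum x) {1..}"
    using log_source_coefficients[OF onv \<sigma> x] by blast
  have "((\<lambda>j. K ((x \<bullet> v j) *\<^sub>R v j) \<bullet> u i) has_sum (K x \<bullet> u i)) {1..}"
    using has_sum_bounded_linear[OF bounded_linear_compose[OF bounded_linear_inner_left K.bounded_linear_axioms] hs]
    by (simp add: comp_def)
  from has_sum_single[OF this, of i] show ?thesis
    using onu Kv i by (auto simp: K.scaleR)
qed

section \<open>The error for a fixed realisation of the noise\<close>

text \<open>
  The pathwise core of the proof.  The hypotheses on \<open>k\<close> and on the noise force the chosen level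
  below \<open>k\<close>, and the three terms of the bound are the propagated noise up to \<open>k\<close>, the bias beyond
  \<open>l\<close>, and the part of the bias between the chosen level and \<open>l\<close>, which the discrepancy inequality
  controls in the image space.
\<close>
lemma log_source_error_bound:
  fixes v :: "nat \<Rightarrow> 'x::{real_inner,complete_space}" and z :: "nat \<Rightarrow> real"
    and a p \<rho> \<delta> \<tau> \<theta> V :: real
  assumes on: "\<forall>i\<ge>1. \<forall>j\<ge>1. v i \<bullet> v j = (if i = j then 1 else 0)"
    and \<sigma>: "\<forall>j\<ge>1. (\<sigma> j)\<^sup>2 = exp (- a * real j)" "\<forall>j\<ge>1. 0 < \<sigma> j" and pos: "a > 0" "p > 0" "\<delta> > 0"
    and x: "x \<in> log_source_set \<sigma> v p \<rho>"
    and d: "\<And>j. j \<ge> 1 \<Longrightarrow> d (u j) = \<sigma> j * (x \<bullet> v j) + \<delta> * z j"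
    and kl: "1 \<le> l" "l \<le> k" and \<tau>\<theta>: "0 \<le> \<theta>" "\<theta> < \<tau>"
    and z: "\<And>m. m \<ge> l \<Longrightarrow> (\<Sum>j=1..m. (z j)\<^sup>2) \<le> \<theta>\<^sup>2 * real m"
    and k: "exp (- a * real k) * (a * real k) powr (- p) * \<rho>\<^sup>2 \<le> (\<tau> - \<theta>)\<^sup>2 * \<delta>\<^sup>2 * real k"
    and V: "(\<Sum>j=1..k. exp (a * real j) * (z j)\<^sup>2) \<le> V"
  shows "(norm (spectral_cutoff \<sigma> u v d (k_dp \<tau> \<delta> u d) - x))\<^sup>2
    \<le> \<delta>\<^sup>2 * V + (a * real l) powr (- p) * \<rho>\<^sup>2 + exp (a * real l) * (2 * \<tau>)\<^sup>2 * real l * \<delta>\<^sup>2"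
proof -
  let ?x = "\<lambda>j. x \<bullet> v j"
  let ?K = "k_dp \<tau> \<delta> u d"
  have \<tau>: "\<tau> > 0" using \<tau>\<theta> by linarith
  have noise: "L2_set (\<lambda>j. \<delta> * z j) {i+1..m} \<le> \<theta> * sqrt (real m) * \<delta>" if "m \<ge> l" for i m
  proof -
    have "(\<Sum>j=i+1..m. (z j)\<^sup>2) \<le> (\<Sum>j=1..m. (z j)\<^sup>2)" by (intro sum_mono2) auto
    also have "\<dots> \<le> \<theta>\<^sup>2 * real m" using z that by blast
    finally have "sqrt (\<Sum>j=i+1..m. (z j)\<^sup>2) \<le> \<theta> * sqrt (real m)"
      using real_sqrt_le_mono \<tau>\<theta>(1) by (fastforce simp: real_sqrt_mult)
    then have "\<delta> * sqrt (\<Sum>j=i+1..m. (z j)\<^sup>2) \<le> \<delta> * (\<theta> * sqrt (real m))"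
      using pos by (intro mult_left_mono) auto
    moreover have "L2_set (\<lambda>j. \<delta> * z j) {i+1..m} = \<delta> * sqrt (\<Sum>j=i+1..m. (z j)\<^sup>2)"
      using pos L2_set_right_distrib[of \<delta> z "{i+1..m}"] by (simp add: L2_set_def)
    ultimately show ?thesis by (simp only: mult_ac)
  qed
  have signal: "L2_set (\<lambda>j. \<sigma> j * ?x j) {k+1..m} \<le> (\<tau> - \<theta>) * sqrt (real m) * \<delta>" if m: "m \<ge> k" for m
  proof -
    have "(\<Sum>j=k+1..m. (\<sigma> j * ?x j)\<^sup>2) \<le> (\<Sum>j=k+1..m. exp (- a * real k) * (?x j)\<^sup>2)"
      using \<sigma>(1) pos by (intro sum_mono) (auto simp: power_mult_distrib intro!: mult_right_mono)
    also have "\<dots> = exp (- a * real k) * (\<Sum>j=k+1..m. (?x j)\<^sup>2)" by (simp add: sum_distrib_left)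
    also have "\<dots> \<le> exp (- a * real k) * ((a * real k) powr (- p) * \<rho>\<^sup>2)"
      using kl by (intro mult_left_mono log_source_tail(1)[OF on \<sigma>(1) pos(1,2) _ x]) auto
    also have "\<dots> \<le> (\<tau> - \<theta>)\<^sup>2 * \<delta>\<^sup>2 * real k" using k by (simp add: mult_ac)
    also have "\<dots> \<le> (\<tau> - \<theta>)\<^sup>2 * \<delta>\<^sup>2 * real m" using m by (intro mult_left_mono) auto
    finally have "sqrt (\<Sum>j=k+1..m. (\<sigma> j * ?x j)\<^sup>2) \<le> sqrt ((\<tau> - \<theta>)\<^sup>2 * \<delta>\<^sup>2 * real m)"
      by (rule real_sqrt_le_mono)
    then show ?thesis using \<tau>\<theta> pos by (simp add: L2_set_def real_sqrt_mult mult_ac)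
  qed
  \<comment> \<open>The margin between \<open>\<theta>\<close> and \<open>\<tau>\<close> is exactly what is left for the signal.\<close>
  have dp: "sqrt (\<Sum>j=k+1..m. (d (u j))\<^sup>2) \<le> \<tau> * sqrt (real m) * \<delta>" if m: "m > k" for m
  proof -
    have "sqrt (\<Sum>j=k+1..m. (d (u j))\<^sup>2) = L2_set (\<lambda>j. \<sigma> j * ?x j + \<delta> * z j) {k+1..m}"
      by (simp add: L2_set_def d)
    also have "\<dots> \<le> (\<tau> - \<theta>) * sqrt (real m) * \<delta> + \<theta> * sqrt (real m) * \<delta>"
      using m kl L2_set_triangle_ineq[of "\<lambda>j. \<sigma> j * ?x j" "\<lambda>j. \<delta> * z j" "{k+1..m}"]
        signal[of m] noise[of m k] by linarith
    finally show ?thesis by (simp add: algebra_simps)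
  qed
  note kdp = k_dp_bounded[where u=u and d=d and k=k, OF \<tau> pos(3) dp]
  \<comment> \<open>Up to the chosen level the reconstruction differs from \<open>x\<close> by amplified noise only.\<close>
  have variance: "(\<Sum>j=1..?K. (d (u j) / \<sigma> j - ?x j)\<^sup>2) \<le> \<delta>\<^sup>2 * V"
  proof -
    have "(\<Sum>j=1..?K. (d (u j) / \<sigma> j - ?x j)\<^sup>2) = (\<Sum>j=1..?K. \<delta>\<^sup>2 * (exp (a * real j) * (z j)\<^sup>2))"
    proof (intro sum.cong refl)
      fix j assume "j \<in> {1..?K}"
      then have j: "j \<ge> 1" by simp
      then have s: "\<sigma> j > 0" using \<sigma>(2) by auto
      have "d (u j) / \<sigma> j - ?x j = \<delta> * z j / \<sigma> j" using s by (simp add: d[OF j] field_simps)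
      then have "(d (u j) / \<sigma> j - ?x j)\<^sup>2 = \<delta>\<^sup>2 * (z j)\<^sup>2 / (\<sigma> j)\<^sup>2"
        by (simp add: power_divide power_mult_distrib)
      then show "(d (u j) / \<sigma> j - ?x j)\<^sup>2 = \<delta>\<^sup>2 * (exp (a * real j) * (z j)\<^sup>2)"
        using \<sigma>(1) j by (simp add: exp_minus field_simps)
    qed
    also have "\<dots> = \<delta>\<^sup>2 * (\<Sum>j=1..?K. exp (a * real j) * (z j)\<^sup>2)" by (simp add: sum_distrib_left)
    also have "\<dots> \<le> \<delta>\<^sup>2 * (\<Sum>j=1..k. exp (a * real j) * (z j)\<^sup>2)"
      using kdp(1) by (intro mult_left_mono sum_mono2) auto
    also have "\<dots> \<le> \<delta>\<^sup>2 * V" using V by (intro mult_left_mono) auto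
    finally show ?thesis .
  qed
  \<comment> \<open>Signal equals data minus noise, and both are small on this range: the data by the discrepancy
      inequality for \<open>m = l\<close>, the noise by assumption.\<close>
  have middle: "(\<Sum>j=?K+1..l. (?x j)\<^sup>2) \<le> exp (a * real l) * (2 * \<tau>)\<^sup>2 * real l * \<delta>\<^sup>2"
  proof -
    have "L2_set (\<lambda>j. \<sigma> j * ?x j) {?K+1..l} = L2_set (\<lambda>j. d (u j) + - (\<delta> * z j)) {?K+1..l}"
      by (simp add: L2_set_def d)
    also have "\<dots> \<le> L2_set (\<lambda>j. d (u j)) {?K+1..l} + L2_set (\<lambda>j. - (\<delta> * z j)) {?K+1..l}"
      by (rule L2_set_triangle_ineq)
    also have "\<dots> \<le> \<tau> * sqrt (real l) * \<delta> + \<theta> * sqrt (real l) * \<delta>"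
      using kdp(2)[of l] noise[of l ?K] kl by (simp add: L2_set_def)
    also have "\<dots> \<le> 2 * \<tau> * sqrt (real l) * \<delta>"
      using \<tau>\<theta> pos by (simp add: mult_right_mono flip: distrib_right)
    finally have "(L2_set (\<lambda>j. \<sigma> j * ?x j) {?K+1..l})\<^sup>2 \<le> (2 * \<tau> * sqrt (real l) * \<delta>)\<^sup>2"
      by (rule power_mono) simp
    then have *: "(\<Sum>j=?K+1..l. (\<sigma> j * ?x j)\<^sup>2) \<le> (2 * \<tau>)\<^sup>2 * real l * \<delta>\<^sup>2"
      by (simp add: L2_set_def sum_nonneg power_mult_distrib)
    have "(\<Sum>j=?K+1..l. (?x j)\<^sup>2) \<le> (\<Sum>j=?K+1..l. exp (a * real l) * (\<sigma> j * ?x j)\<^sup>2)"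
    proof (rule sum_mono)
      fix j assume j: "j \<in> {?K+1..l}"
      have "1 \<le> exp (a * real l) * exp (- a * real j)"
        using j pos by (simp flip: exp_add)
      then have "1 * (?x j)\<^sup>2 \<le> exp (a * real l) * exp (- a * real j) * (?x j)\<^sup>2"
        by (rule mult_right_mono) simp
      then show "(?x j)\<^sup>2 \<le> exp (a * real l) * (\<sigma> j * ?x j)\<^sup>2"
        using \<sigma>(1) j by (simp add: power_mult_distrib mult_ac)
    qed
    also have "\<dots> = exp (a * real l) * (\<Sum>j=?K+1..l. (\<sigma> j * ?x j)\<^sup>2)" by (simp add: sum_distrib_left)
    also have "\<dots> \<le> exp (a * real l) * ((2 * \<tau>)\<^sup>2 * real l * \<delta>\<^sup>2)"
      using * by (intro mult_left_mono) auto
    finally show ?thesis by (simp add: mult_ac)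
  qed
  have "(\<Sum>j=1..l. (?x j)\<^sup>2) \<le> (\<Sum>j\<in>{1..?K} \<union> {?K+1..l}. (?x j)\<^sup>2)"
    by (intro sum_mono2) auto
  also have "\<dots> = (\<Sum>j=1..?K. (?x j)\<^sup>2) + (\<Sum>j=?K+1..l. (?x j)\<^sup>2)"
    by (intro sum.union_disjoint) auto
  finally have bias: "(norm x)\<^sup>2 - (\<Sum>j=1..?K. (?x j)\<^sup>2)
      \<le> (a * real l) powr (- p) * \<rho>\<^sup>2 + exp (a * real l) * (2 * \<tau>)\<^sup>2 * real l * \<delta>\<^sup>2"
    using log_source_tail(2)[OF on \<sigma>(1) pos(1,2) kl(1) x] middle by linarith
  show ?thesis
    unfolding spectral_cutoff_def using norm_sq_sum_minus[OF on, of "{1..?K}" "\<lambda>j. d (u j) / \<sigma> j" x]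
      variance bias by auto
qed

section \<open>The two truncation levels\<close>

text \<open>
  The choice \<open>q = p + 1/2\<close> gives the upper level \<open>k\<close>, which the discrepancy principle does not
  exceed, and \<open>q = p + 2\<close> the lower level \<open>l\<close>, from which the bias is estimated.
\<close>
definition level :: "real \<Rightarrow> real \<Rightarrow> real \<Rightarrow> nat" where
  "level a q s = nat \<lfloor>(s - q * ln s) / a\<rfloor>"

lemma level_bounds:
  assumes "a > 0" "q * ln s \<le> s"
  shows "s - q * ln s - a \<le> a * real (level a q s)" "a * real (level a q s) \<le> s - q * ln s"
proof -
  have "0 \<le> (s - q * ln s) / a" using assms by simp
  then have "(s - q * ln s) / a - 1 \<le> real (level a q s)" "real (level a q s) \<le> (s - q * ln s) / a"
    unfolding level_def by linarith+
  then show "s - q * ln s - a \<le> a * real (level a q s)" "a * real (level a q s) \<le> s - q * ln s"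
    using assms(1) by (simp_all add: field_simps)
qed

lemma eventually_log_le: "eventually (\<lambda>s::real. q * ln s \<le> s) at_top"
  by real_asymp

lemma filterlim_level:
  assumes "a > 0" shows "filterlim (level a q) at_top at_top"
  unfolding level_def
proof (rule filterlim_compose[OF filterlim_nat_sequentially])
  have "filterlim (\<lambda>s. (s - q * ln s) / a) at_top at_top" using assms by real_asymp
  then show "filterlim (\<lambda>s. \<lfloor>(s - q * ln s) / a\<rfloor>) at_top at_top"
    by (rule filterlim_compose[OF filterlim_floor_sequentially])
qed

lemma level_ratio_tendsto:
  assumes "a > 0" shows "((\<lambda>s. a * real (level a q s) / s) \<longlongrightarrow> 1) at_top"
proof (rule tendsto_sandwich)
  show "((\<lambda>s. (s - q * ln s - a) / s) \<longlongrightarrow> 1) at_top" by real_asymp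
  show "((\<lambda>s. (s - q * ln s) / s) \<longlongrightarrow> 1) at_top" by real_asymp
  show "eventually (\<lambda>s. (s - q * ln s - a) / s \<le> a * real (level a q s) / s) at_top"
    using eventually_log_le[of q] eventually_gt_at_top[of 0]
    by eventually_elim (auto intro!: divide_right_mono level_bounds assms)
  show "eventually (\<lambda>s. a * real (level a q s) / s \<le> (s - q * ln s) / s) at_top"
    using eventually_log_le[of q] eventually_gt_at_top[of 0]
    by eventually_elim (auto intro!: divide_right_mono level_bounds assms)
qed

lemma level_antimono:
  assumes "a > 0" "s \<ge> 1" "q \<le> q'" shows "level a q' s \<le> level a q s"
  unfolding level_def using assms
  by (intro nat_mono floor_mono divide_right_mono diff_left_mono mult_right_mono) auto

lemma level_ge_1:
  assumes "a > 0" shows "eventually (\<lambda>s. level a q s \<ge> 1) at_top"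
  using filterlim_level[OF assms, of q] unfolding filterlim_at_top by auto

text \<open>
  The left-hand side is of order \<open>exp (- s) s\<^bsup>p + 1/2\<^esup> s\<^bsup>-p\<^esup>\<close>, hence smaller than the right-hand
  side by a factor of order \<open>s\<^bsup>-1/2\<^esup>\<close>.  Any shift \<open>q ln s\<close> with \<open>q < p + 1\<close> would do here, whereas
  the propagated noise requires \<open>q > p\<close>.
\<close>
lemma level_signal_small:
  assumes "a > 0" "p > 0" "c > 0"
  defines "k \<equiv> level a (p + 1/2)"
  shows "eventually (\<lambda>s. exp (- a * real (k s)) * (a * real (k s)) powr (- p) \<le> c * exp (- s) * real (k s)) at_top"
proof -
  have pos: "eventually (\<lambda>s. s - (p + 1/2) * ln s - a > 0) at_top" by real_asymp
  have main: "eventually (\<lambda>s. exp a * s powr (p + 1/2) * (s - (p + 1/2) * ln s - a) powr (- p)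
      \<le> c * ((s - (p + 1/2) * ln s - a) / a)) at_top"
    using assms(1-3) by real_asymp
  show ?thesis
    using pos main eventually_log_le[of "p + 1/2"] eventually_gt_at_top[of 0]
  proof eventually_elim
    case (elim s)
    let ?L = "s - (p + 1/2) * ln s - a"
    have b: "?L \<le> a * real (k s)" unfolding k_def using level_bounds(1)[OF assms(1) elim(3)] by simp
    have "exp (- a * real (k s)) \<le> exp (- ?L)" using b by simp
    also have "\<dots> = exp (- s) * (exp a * s powr (p + 1/2))"
      using elim by (simp add: powr_def flip: exp_add)
    finally have 1: "exp (- a * real (k s)) \<le> exp (- s) * (exp a * s powr (p + 1/2))" .
    have 2: "(a * real (k s)) powr (- p) \<le> ?L powr (- p)"
      using elim b assms by (intro powr_mono2') auto
    have 3: "?L / a \<le> real (k s)" using b assms by (simp add: field_simps)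
    have "exp (- a * real (k s)) * (a * real (k s)) powr (- p)
        \<le> exp (- s) * (exp a * s powr (p + 1/2)) * ?L powr (- p)"
      by (rule mult_mono[OF 1 2]) auto
    also have "\<dots> = exp (- s) * (exp a * s powr (p + 1/2) * ?L powr (- p))" by simp
    also have "\<dots> \<le> exp (- s) * (c * (?L / a))" using elim by (intro mult_left_mono) auto
    also have "\<dots> \<le> exp (- s) * (c * real (k s))" using 3 assms by (intro mult_left_mono) auto
    finally show ?case by (simp add: mult_ac)
  qed
qed

text \<open>
  The bound on the squared error divided by \<open>\<rho>\<^sup>2 s\<^bsup>-p\<^esup>\<close>: propagated noise, bias beyond the lower
  level, and bias between the chosen and the lower level.  The square root of this quantity is the
  factor \<open>1 + o(1)\<close> of the theorem.
\<close>
definition relative_risk :: "real \<Rightarrow> real \<Rightarrow> real \<Rightarrow> real \<Rightarrow> real" where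
  "relative_risk a p \<tau> s = (let l = level a (p + 2) s in
     s powr (- 1/4) + (a * real l / s) powr (- p) + s powr p * exp (a * real l - s) * (2 * \<tau>)\<^sup>2 * real l)"

lemma relative_risk_nonneg: "s \<ge> 0 \<Longrightarrow> 0 \<le> relative_risk a p \<tau> s"
  unfolding relative_risk_def Let_def by (intro add_nonneg_nonneg mult_nonneg_nonneg) auto

text \<open>
  The last term is of order \<open>s\<^sup>p s\<^bsup>-(p + 2)\<^esup> s = s\<^bsup>-1\<^esup>\<close>; this is where the shift \<open>(p + 2) ln s\<close> of
  the lower level is needed.
\<close>
lemma relative_risk_tendsto_1:
  assumes "a > 0" "p > 0"
  shows "(relative_risk a p \<tau> \<longlongrightarrow> 1) at_top"
proof -
  let ?l = "\<lambda>s. real (level a (p + 2) s)"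
  have "((\<lambda>s. s powr p * exp (a * ?l s - s) * (2 * \<tau>)\<^sup>2 * ?l s) \<longlongrightarrow> 0) at_top"
  proof (rule tendsto_sandwich[OF _ _ tendsto_const])
    show "((\<lambda>s. (2 * \<tau>)\<^sup>2 / a / s) \<longlongrightarrow> 0) at_top" using assms by real_asymp
    show "eventually (\<lambda>s. 0 \<le> s powr p * exp (a * ?l s - s) * (2 * \<tau>)\<^sup>2 * ?l s) at_top" by simp
    show "eventually (\<lambda>s. s powr p * exp (a * ?l s - s) * (2 * \<tau>)\<^sup>2 * ?l s \<le> (2 * \<tau>)\<^sup>2 / a / s) at_top"
      using eventually_log_le[of "p + 2"] eventually_ge_at_top[of 1]
    proof eventually_elim
      case (elim s)
      note b = level_bounds(2)[OF assms(1) elim(1)]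
      have "0 \<le> (p + 2) * ln s" using elim assms by simp
      with b have "a * ?l s \<le> s" by linarith
      then have l: "?l s \<le> s / a" using assms by (simp add: field_simps)
      have "exp (a * ?l s - s) \<le> exp (- (p + 2) * ln s)" using b by (simp add: algebra_simps)
      also have "\<dots> = s powr (- (p + 2))" using elim by (simp add: powr_def)
      finally have "s powr p * exp (a * ?l s - s) * (2 * \<tau>)\<^sup>2 * ?l s
          \<le> s powr p * s powr (- (p + 2)) * (2 * \<tau>)\<^sup>2 * (s / a)"
        using l by (intro mult_mono mult_nonneg_nonneg) auto
      also have "s powr p * s powr (- (p + 2)) = s powr (- 2)" by (simp flip: powr_add)
      also have "\<dots> = 1 / s\<^sup>2" using elim by (simp add: powr_minus_divide powr_numeral)
      finally show ?case using elim by (simp add: field_simps power2_eq_square)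
    qed
  qed
  moreover have "((\<lambda>s. (a * ?l s / s) powr (- p)) \<longlongrightarrow> 1 powr (- p)) at_top"
    by (intro tendsto_powr level_ratio_tendsto assms tendsto_const) simp
  moreover have "((\<lambda>s::real. s powr (- 1/4)) \<longlongrightarrow> 0) at_top" by real_asymp
  ultimately have "((\<lambda>s. s powr (- 1/4) + (a * ?l s / s) powr (- p) + s powr p * exp (a * ?l s - s) * (2 * \<tau>)\<^sup>2 * ?l s)
      \<longlongrightarrow> 0 + 1 powr (- p) + 0) at_top"
    by (intro tendsto_add)
  then show ?thesis unfolding relative_risk_def[abs_def] Let_def by simp
qed

section \<open>Probability estimates\<close>

lemma sum_exp_le:
  assumes "a > 0"
  shows "(\<Sum>j=1..k. exp (a * real j)) \<le> exp (a * real k) / (1 - exp (- a))"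
proof (induction k)
  case (Suc k)
  have "(\<Sum>j=1..Suc k. exp (a * real j)) \<le> exp (a * real k) / (1 - exp (- a)) + exp (a * real (Suc k))"
    using Suc by simp
  also have "exp (a * real k) = exp (a * real (Suc k)) * exp (- a)"
    by (simp add: algebra_simps flip: exp_add)
  also have "exp (a * real (Suc k)) * exp (- a) / (1 - exp (- a)) + exp (a * real (Suc k))
      = exp (a * real (Suc k)) / (1 - exp (- a))"
    using assms by (simp add: field_simps)
  finally show ?case .
qed (use assms in auto)

lemma (in prob_space) propagated_noise_markov:
  fixes \<zeta> :: "nat \<Rightarrow> 'a \<Rightarrow> real"
  assumes int: "\<And>j. j \<ge> 1 \<Longrightarrow> integrable M (\<lambda>\<omega>. (\<zeta> j \<omega>)\<^sup>2)"
    and E: "\<And>j. j \<ge> 1 \<Longrightarrow> expectation (\<lambda>\<omega>. (\<zeta> j \<omega>)\<^sup>2) = 1" and a: "a > 0" and c: "c > 0"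
  shows "prob {\<omega> \<in> space M. c \<le> (\<Sum>j=1..k. exp (a * real j) * (\<zeta> j \<omega>)\<^sup>2)}
    \<le> exp (a * real k) / (1 - exp (- a)) / c"
proof -
  let ?V = "\<lambda>\<omega>. \<Sum>j=1..k. exp (a * real j) * (\<zeta> j \<omega>)\<^sup>2"
  have intV: "integrable M ?V" using int by (intro Bochner_Integration.integrable_sum) auto
  have "prob {\<omega> \<in> space M. c \<le> ?V \<omega>} \<le> expectation ?V / c"
    by (rule integral_Markov_inequality_measure[OF intV, of "{}"]) (auto intro!: sum_nonneg c)
  also have "expectation ?V = (\<Sum>j=1..k. exp (a * real j))"
    using int E by (subst Bochner_Integration.integral_sum) auto
  also have "(\<Sum>j=1..k. exp (a * real j)) / c \<le> exp (a * real k) / (1 - exp (- a)) / c"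
    using sum_exp_le[OF a] c by (intro divide_right_mono) auto
  finally show ?thesis .
qed

lemma filterlim_log_noise_ratio:
  "filterlim (\<lambda>(\<delta>, \<rho>). - ln (\<delta>\<^sup>2 / \<rho>\<^sup>2)) at_top noise_ratio_to_0"
proof -
  have "filterlim (\<lambda>(\<delta>, \<rho>). \<delta> / \<rho>) (at_right 0) noise_ratio_to_0"
    unfolding noise_ratio_to_0_def
    by (rule filterlim_mono[OF filterlim_filtercomap order_refl inf_le1])
  moreover have "filterlim (\<lambda>t::real. - ln (t\<^sup>2)) at_top (at_right 0)" by real_asymp
  ultimately have "filterlim (\<lambda>z. - ln (((\<lambda>(\<delta>, \<rho>). \<delta> / \<rho>) z)\<^sup>2)) at_top noise_ratio_to_0"
    by (rule filterlim_compose[rotated])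
  then show ?thesis by (simp add: case_prod_unfold power_divide)
qed

lemma eventually_noise_ratio_pos: "eventually (\<lambda>(\<delta>, \<rho>). \<delta> > 0 \<and> \<rho> > 0) noise_ratio_to_0"
  unfolding noise_ratio_to_0_def eventually_inf_principal by (intro always_eventually) auto

lemma k_dp_measurable:
  fixes f :: "'w \<Rightarrow> 'y \<Rightarrow> real"
  assumes "\<And>j. j \<ge> 1 \<Longrightarrow> (\<lambda>\<omega>. f \<omega> (u j)) \<in> borel_measurable M"
  shows "(\<lambda>\<omega>. k_dp \<tau> \<delta> u (f \<omega>)) \<in> measurable M (count_space UNIV)"
proof -
  have s: "(\<lambda>\<omega>. \<Sum>j=k+1..m. (f \<omega> (u j))\<^sup>2) \<in> borel_measurable M" for k m
    using assms by (intro borel_measurable_sum borel_measurable_power) auto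
  have at: "(\<lambda>\<omega>. k_dp_at \<tau> \<delta> u (f \<omega>) m) \<in> measurable M (count_space UNIV)" for m
    unfolding k_dp_at_def using s by measurable
  have "(\<lambda>\<omega>. Max {k. \<exists>m\<in>{1..}. k_dp_at \<tau> \<delta> u (f \<omega>) m = k}) \<in> measurable M (count_space UNIV)"
    using at by measurable
  also have "(\<lambda>\<omega>. Max {k. \<exists>m\<in>{1..}. k_dp_at \<tau> \<delta> u (f \<omega>) m = k}) = (\<lambda>\<omega>. k_dp \<tau> \<delta> u (f \<omega>))"
    unfolding k_dp_def by (intro ext arg_cong[of _ _ Max]) auto
  finally show ?thesis .
qed

lemma dp_error_measurable:
  fixes f :: "'w \<Rightarrow> 'y \<Rightarrow> real" and v :: "nat \<Rightarrow> 'x::{real_inner,complete_space}"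
  assumes on: "\<forall>i\<ge>1. \<forall>j\<ge>1. v i \<bullet> v j = (if i = j then 1 else 0)"
    and f: "\<And>j. j \<ge> 1 \<Longrightarrow> (\<lambda>\<omega>. f \<omega> (u j)) \<in> borel_measurable M"
  shows "(\<lambda>\<omega>. norm (spectral_cutoff \<sigma> u v (f \<omega>) (k_dp \<tau> \<delta> u (f \<omega>)) - x)) \<in> borel_measurable M"
proof (rule measurable_compose_countable[OF _ k_dp_measurable[of f u M, OF f]])
  fix k :: nat
  have "norm (spectral_cutoff \<sigma> u v (f \<omega>) k - x)
      = sqrt ((\<Sum>j=1..k. (f \<omega> (u j) / \<sigma> j - x \<bullet> v j)\<^sup>2) + ((norm x)\<^sup>2 - (\<Sum>j=1..k. (x \<bullet> v j)\<^sup>2)))" for \<omega>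
    unfolding spectral_cutoff_def
    by (subst norm_sq_sum_minus[OF on, symmetric]) auto
  moreover have "(\<lambda>\<omega>. \<Sum>j=1..k. (f \<omega> (u j) / \<sigma> j - x \<bullet> v j)\<^sup>2) \<in> borel_measurable M"
    using f by (intro borel_measurable_sum borel_measurable_power borel_measurable_diff borel_measurable_divide) auto
  ultimately show "(\<lambda>\<omega>. norm (spectral_cutoff \<sigma> u v (f \<omega>) k - x)) \<in> borel_measurable M"
    by simp
qed

lemma zero_in_log_source_set: "\<rho> > 0 \<Longrightarrow> 0 \<in> log_source_set \<sigma> v p \<rho>"
  unfolding log_source_set_def by (auto intro!: exI[of _ 0])

text \<open>
  The test is homogeneous: data and threshold scale by the same factor.
\<close>
lemma k_dp_scale:
  assumes "\<delta> > 0" shows "k_dp \<tau> \<delta> u (\<lambda>y. \<delta> * d y) = k_dp \<tau> 1 u d"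
proof -
  have "sqrt (\<Sum>j=k+1..m. (\<delta> * d (u j))\<^sup>2) \<le> \<tau> * sqrt (real m) * \<delta>
      \<longleftrightarrow> sqrt (\<Sum>j=k+1..m. (d (u j))\<^sup>2) \<le> \<tau> * sqrt (real m) * 1" for k m
  proof -
    have "(\<Sum>j=k+1..m. (\<delta> * d (u j))\<^sup>2) = \<delta>\<^sup>2 * (\<Sum>j=k+1..m. (d (u j))\<^sup>2)"
      by (simp add: power_mult_distrib sum_distrib_left)
    then have "sqrt (\<Sum>j=k+1..m. (\<delta> * d (u j))\<^sup>2) = sqrt (\<Sum>j=k+1..m. (d (u j))\<^sup>2) * \<delta>"
      using assms by (simp add: real_sqrt_mult mult.commute)
    then show ?thesis using assms by simp
  qed
  then show ?thesis unfolding k_dp_def k_dp_at_def by presburger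
qed

text \<open>
  For the exact solution \<open>0\<close> everything is homogeneous in \<open>\<delta>\<close>, so the success probability is a
  value of one distribution function that does not change with \<open>\<delta>\<close>.
\<close>
lemma zero_solution_success_prob:
  fixes v :: "nat \<Rightarrow> 'x::{real_inner,complete_space}"
  assumes K: "K 0 = 0" and \<delta>: "\<delta> > 0"
    and on: "\<forall>i\<ge>1. \<forall>j\<ge>1. v i \<bullet> v j = (if i = j then 1 else 0)"
    and Z: "\<And>y. Z y \<in> borel_measurable M"
  shows "dp_success_prob M K \<sigma> u v Z \<tau> \<delta> B 0
    = cdf (distr M borel (\<lambda>\<omega>. norm (spectral_cutoff \<sigma> u v (\<lambda>y. Z y \<omega>) (k_dp \<tau> 1 u (\<lambda>y. Z y \<omega>))))) (B / \<delta>)"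
proof -
  let ?W = "\<lambda>\<omega>. norm (spectral_cutoff \<sigma> u v (\<lambda>y. Z y \<omega>) (k_dp \<tau> 1 u (\<lambda>y. Z y \<omega>)))"
  have W: "?W \<in> borel_measurable M"
    using dp_error_measurable[OF on, of "\<lambda>\<omega> y. Z y \<omega>" u M \<sigma> \<tau> 1 0] Z by simp
  have data: "noisy_data K Z \<delta> 0 \<omega> = (\<lambda>y. \<delta> * Z y \<omega>)" for \<omega>
    by (auto simp: noisy_data_def K)
  have "spectral_cutoff \<sigma> u v (\<lambda>y. \<delta> * Z y \<omega>) k = \<delta> *\<^sub>R spectral_cutoff \<sigma> u v (\<lambda>y. Z y \<omega>) k" for k \<omega>
    by (simp add: spectral_cutoff_def scaleR_sum_right)
  then have "norm (spectral_cutoff \<sigma> u v (noisy_data K Z \<delta> 0 \<omega>) (k_dp \<tau> \<delta> u (noisy_data K Z \<delta> 0 \<omega>)) - 0)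
      = \<delta> * ?W \<omega>" for \<omega>
    unfolding data using k_dp_scale[OF \<delta>, of \<tau> u "\<lambda>y. Z y \<omega>"] \<delta> by simp
  then have "dp_success_prob M K \<sigma> u v Z \<tau> \<delta> B 0 = measure M {\<omega> \<in> space M. ?W \<omega> \<le> B / \<delta>}"
    unfolding dp_success_prob_def using \<delta> by (simp add: field_simps)
  also have "\<dots> = cdf (distr M borel ?W) (B / \<delta>)"
    unfolding cdf_def by (subst measure_distr[OF W]) (auto intro!: arg_cong[of _ _ "measure M"])
  finally show ?thesis .
qed

text \<open>
  Failure requires that the law of large numbers bound fails after \<open>l\<close> or that the propagated
  noise exceeds \<open>exp s s\<^bsup>-p - 1/4\<^esup>\<close>.  The latter threshold lies between the expectation, of order
  \<open>exp s s\<^bsup>-p - 1/2\<^esup>\<close>, and the admissible \<open>exp s s\<^bsup>-p\<^esup>\<close>, so both the probability of exceeding it and its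
  share of the risk vanish like \<open>s\<^bsup>-1/4\<^esup>\<close>.
\<close>
lemma dp_success_prob_lower_bound:
  fixes K :: "'x::{real_inner,complete_space} \<Rightarrow> 'y::{real_inner,complete_space}" and M :: "'w measure"
  assumes "prob_space M" and K: "compact_operator K" and svd: "singular_value_decomposition K \<sigma> u v"
    and wn: "white_noise M Z"
    and a: "a > 0" and \<sigma>: "\<forall>j\<ge>1. (\<sigma> j)\<^sup>2 = exp (- a * real j)" and p: "p > 0" and \<tau>\<theta>: "0 \<le> \<theta>" "\<theta> < \<tau>"
    and pos: "\<delta> > 0" "\<rho> > 0" and x: "x \<in> log_source_set \<sigma> v p \<rho>"
  defines "s \<equiv> - ln (\<delta>\<^sup>2 / \<rho>\<^sup>2)"
  defines "l \<equiv> level a (p + 2) s" and "k \<equiv> level a (p + 1/2) s"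
  assumes s: "s \<ge> 1" "(p + 1/2) * ln s \<le> s" and l: "l \<ge> 1"
    and signal: "exp (- a * real k) * (a * real k) powr (- p) \<le> (\<tau> - \<theta>)\<^sup>2 * exp (- s) * real k"
  shows "measure M {\<omega> \<in> space M. \<forall>m\<ge>l. (\<Sum>j=1..m. (Z (u j) \<omega>)\<^sup>2) \<le> \<theta>\<^sup>2 * real m}
      - s powr (- 1/4) / (1 - exp (- a))
    \<le> dp_success_prob M K \<sigma> u v Z \<tau> \<delta> (\<rho> * s powr (- p / 2) * sqrt (relative_risk a p \<tau> s)) x"
proof -
  interpret prob_space M by fact
  have onv: "\<forall>i\<ge>1. \<forall>j\<ge>1. v i \<bullet> v j = (if i = j then 1 else 0)"
    and onu: "\<forall>i\<ge>1. \<forall>j\<ge>1. u i \<bullet> u j = (if i = j then 1 else 0)"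
    and \<sigma>pos: "\<forall>j\<ge>1. 0 < \<sigma> j"
    using svd unfolding singular_value_decomposition_def orthonormal_basis_of_def by auto
  have Zm[measurable]: "Z y \<in> borel_measurable M" and Zi: "integrable M (\<lambda>\<omega>. (Z y \<omega>)\<^sup>2)"
    and ZE: "expectation (\<lambda>\<omega>. (Z y \<omega>)\<^sup>2) = y \<bullet> y" for y
    using wn by (auto simp: white_noise_def power2_eq_square)
  have \<delta>s: "\<delta>\<^sup>2 = \<rho>\<^sup>2 * exp (- s)" using pos by (simp add: s_def field_simps)
  define c where "c = exp s * s powr (- p - 1/4)"
  have c: "c > 0" using s by (simp add: c_def)
  define R where "R = \<rho> * s powr (- p / 2) * sqrt (relative_risk a p \<tau> s)"
  let ?err = "\<lambda>\<omega>. norm (spectral_cutoff \<sigma> u v (noisy_data K Z \<delta> x \<omega>) (k_dp \<tau> \<delta> u (noisy_data K Z \<delta> x \<omega>)) - x)"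
  let ?V = "\<lambda>\<omega>. \<Sum>j=1..k. exp (a * real j) * (Z (u j) \<omega>)\<^sup>2"
  let ?E = "{\<omega> \<in> space M. \<forall>m\<ge>l. (\<Sum>j=1..m. (Z (u j) \<omega>)\<^sup>2) \<le> \<theta>\<^sup>2 * real m}"
  let ?N = "{\<omega> \<in> space M. c \<le> ?V \<omega>}"
  have E: "?E \<in> sets M" and N: "?N \<in> sets M" by measurable
  have "exp (a * real k) \<le> exp s * s powr (- (p + 1/2))"
  proof -
    have "exp (a * real k) \<le> exp (s - (p + 1/2) * ln s)"
      unfolding k_def using level_bounds(2)[OF a s(2)] by simp
    also have "\<dots> = exp s * s powr (- (p + 1/2))" using s by (simp add: powr_def algebra_simps flip: exp_add)
    finally show ?thesis .
  qed
  then have "exp (a * real k) / (1 - exp (- a)) / c \<le> exp s * s powr (- (p + 1/2)) / (1 - exp (- a)) / c"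
    using a c by (intro divide_right_mono) auto
  also have "\<dots> = s powr (- (p + 1/2)) / s powr (- p - 1/4) / (1 - exp (- a))"
    by (simp add: c_def)
  also have "s powr (- (p + 1/2)) / s powr (- p - 1/4) = s powr (- 1/4)"
    by (simp flip: powr_diff)
  finally have PN: "prob ?N \<le> s powr (- 1/4) / (1 - exp (- a))"
    using propagated_noise_markov[of "\<lambda>j. Z (u j)", OF _ _ a c, of k] Zi ZE onu by force
  have R2: "R\<^sup>2 = \<delta>\<^sup>2 * c + (a * real l) powr (- p) * \<rho>\<^sup>2 + exp (a * real l) * (2 * \<tau>)\<^sup>2 * real l * \<delta>\<^sup>2"
  proof -
    have "R\<^sup>2 = \<rho>\<^sup>2 * s powr (- p) * relative_risk a p \<tau> s"
      using s relative_risk_nonneg[of s a p \<tau>] by (simp add: R_def power_mult_distrib powr_power)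
    also have "relative_risk a p \<tau> s = s powr (- 1/4) + (a * real l) powr (- p) / s powr (- p)
        + s powr p * exp (a * real l - s) * (2 * \<tau>)\<^sup>2 * real l"
      using s a unfolding relative_risk_def Let_def l_def by (simp add: powr_divide)
    also have "\<rho>\<^sup>2 * s powr (- p) * \<dots> = \<rho>\<^sup>2 * (s powr (- p) * s powr (- 1/4)) + (a * real l) powr (- p) * \<rho>\<^sup>2
        + (s powr (- p) * s powr p) * (exp (a * real l - s) * (2 * \<tau>)\<^sup>2 * real l * \<rho>\<^sup>2)"
      using s by (simp add: algebra_simps)
    also have "s powr (- p) * s powr (- 1/4) = s powr (- p - 1/4)" by (simp flip: powr_add)
    also have "s powr (- p) * s powr p = 1" using s by (simp flip: powr_add)
    finally show ?thesis
      using pos by (simp add: \<delta>s c_def exp_diff exp_minus field_simps)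
  qed
  have R: "R \<ge> 0" using pos s relative_risk_nonneg[of s a p \<tau>] by (simp add: R_def)
  have good: "?err \<omega> \<le> R" if \<omega>: "\<omega> \<in> ?E - ?N" for \<omega>
  proof -
    have "(?err \<omega>)\<^sup>2 \<le> R\<^sup>2"
      unfolding R2
    proof (rule log_source_error_bound[OF onv \<sigma> \<sigma>pos a p pos(1) x _ l _ \<tau>\<theta>, where z = "\<lambda>j. Z (u j) \<omega>"])
      show "noisy_data K Z \<delta> x \<omega> (u j) = \<sigma> j * (x \<bullet> v j) + \<delta> * Z (u j) \<omega>" if "j \<ge> 1" for j
        using log_source_image_coefficient[OF K svd \<sigma> x that] by (simp add: noisy_data_def)
      show "l \<le> k" unfolding l_def k_def using a s by (intro level_antimono) auto
      show "(\<Sum>j=1..m. (Z (u j) \<omega>)\<^sup>2) \<le> \<theta>\<^sup>2 * real m" if "m \<ge> l" for m using \<omega> that by auto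
      show "exp (- a * real k) * (a * real k) powr (- p) * \<rho>\<^sup>2 \<le> (\<tau> - \<theta>)\<^sup>2 * \<delta>\<^sup>2 * real k"
        using mult_right_mono[OF signal, of "\<rho>\<^sup>2"] by (simp add: \<delta>s mult_ac)
      show "?V \<omega> \<le> c" using \<omega> by auto
    qed
    then show ?thesis using R by (rule power2_le_imp_le)
  qed
  have "?err \<in> borel_measurable M"
    by (rule dp_error_measurable[OF onv]) (simp add: noisy_data_def)
  then have S: "{\<omega> \<in> space M. ?err \<omega> \<le> R} \<in> sets M" by measurable
  have "prob ?E \<le> prob (?E - ?N) + prob ?N"
    using E N measure_Un_le[of "?E - ?N" M ?N] finite_measure_mono[of ?E "(?E - ?N) \<union> ?N"] by fastforce
  moreover have "prob (?E - ?N) \<le> prob {\<omega> \<in> space M. ?err \<omega> \<le> R}"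
    using good S by (intro finite_measure_mono) auto
  ultimately show ?thesis unfolding dp_success_prob_def R_def[symmetric] using PN by linarith
qed

theorem theorem2p5:
  fixes K :: "'x::{real_inner,complete_space} \<Rightarrow> 'y::{real_inner,complete_space}"
    and \<sigma> :: "nat \<Rightarrow> real" and u :: "nat \<Rightarrow> 'y" and v :: "nat \<Rightarrow> 'x"
    and M :: "'w measure" and Z :: "'y \<Rightarrow> 'w \<Rightarrow> real"
    and a \<tau> p :: real
  assumes "compact_operator K" and "closure (range K) = UNIV"
    and "singular_value_decomposition K \<sigma> u v"
    and "prob_space M" and "white_noise M Z"
    and "a > 0" and "\<forall>j\<ge>1. (\<sigma> j)\<^sup>2 = exp (- a * real j)"
    and "\<tau> > 1" and "p > 0"
  shows "\<exists>\<epsilon> :: real \<times> real \<Rightarrow> real. (\<epsilon> \<longlongrightarrow> 0) noise_ratio_to_0 \<and>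
    ((\<lambda>(\<delta>, \<rho>). SUP x \<in> log_source_set \<sigma> v p \<rho>.
        dp_success_prob M K \<sigma> u v Z \<tau> \<delta>
          (\<rho> * (- ln (\<delta>\<^sup>2 / \<rho>\<^sup>2)) powr (- p / 2) * (1 + \<epsilon> (\<delta>, \<rho>))) x)
      \<longlongrightarrow> 1) noise_ratio_to_0 \<and>
    (iid_coefficients M Z u \<longrightarrow>
     ((\<lambda>(\<delta>, \<rho>). INF x \<in> log_source_set \<sigma> v p \<rho>.
        dp_success_prob M K \<sigma> u v Z \<tau> \<delta>
          (\<rho> * (- ln (\<delta>\<^sup>2 / \<rho>\<^sup>2)) powr (- p / 2) * (1 + \<epsilon> (\<delta>, \<rho>))) x)
      \<longlongrightarrow> 1) noise_ratio_to_0)"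
proof -
  note K = assms(1) and svd = assms(3) and wn = assms(5) and a = assms(6) and \<sigma> = assms(7) and p = assms(9)
  interpret prob_space M by fact
  interpret K: bounded_linear K by (rule compact_operator_bounded_linear[OF K])
  have onv: "\<forall>i\<ge>1. \<forall>j\<ge>1. v i \<bullet> v j = (if i = j then 1 else 0)"
    and onu: "\<forall>i\<ge>1. \<forall>j\<ge>1. u i \<bullet> u j = (if i = j then 1 else 0)"
    using svd unfolding singular_value_decomposition_def orthonormal_basis_of_def by auto
  have Zm: "Z y \<in> borel_measurable M" and Zi: "integrable M (\<lambda>\<omega>. (Z y \<omega>)\<^sup>2)"
    and ZE: "expectation (\<lambda>\<omega>. (Z y \<omega>)\<^sup>2) = y \<bullet> y" for y
    using wn by (auto simp: white_noise_def power2_eq_square)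
  define S :: "real \<times> real \<Rightarrow> real" where "S = (\<lambda>(\<delta>, \<rho>). - ln (\<delta>\<^sup>2 / \<rho>\<^sup>2))"
  have S: "filterlim S at_top noise_ratio_to_0"
    unfolding S_def by (rule filterlim_log_noise_ratio)
  define \<epsilon> :: "real \<times> real \<Rightarrow> real" where "\<epsilon> = (\<lambda>z. sqrt (relative_risk a p \<tau> (S z)) - 1)"
  define P :: "real \<Rightarrow> real \<Rightarrow> 'x \<Rightarrow> real" where "P = (\<lambda>\<delta> \<rho> x. dp_success_prob M K \<sigma> u v Z \<tau> \<delta>
          (\<rho> * (- ln (\<delta>\<^sup>2 / \<rho>\<^sup>2)) powr (- p / 2) * (1 + \<epsilon> (\<delta>, \<rho>))) x)"
  have P01: "0 \<le> P \<delta> \<rho> x" "P \<delta> \<rho> x \<le> 1" for \<delta> \<rho> x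
    unfolding P_def dp_success_prob_def by auto
  have bdd: "bdd_above (P \<delta> \<rho> ` A)" "bdd_below (P \<delta> \<rho> ` A)" for \<delta> \<rho> A
    by (auto intro!: bdd_aboveI[of _ 1] bdd_belowI[of _ 0] simp: P01)
  have ne: "0 \<in> log_source_set \<sigma> v p \<rho>" if "\<rho> > 0" for \<rho>
    using that by (rule zero_in_log_source_set)
  have risk: "((\<lambda>z. sqrt (relative_risk a p \<tau> (S z))) \<longlongrightarrow> 1) noise_ratio_to_0"
    using tendsto_real_sqrt[OF filterlim_compose[OF relative_risk_tendsto_1[OF a p] S]] by simp
  have \<epsilon>: "(\<epsilon> \<longlongrightarrow> 0) noise_ratio_to_0"
    using tendsto_diff[OF risk tendsto_const[of 1]] by (simp add: \<epsilon>_def)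
  \<comment> \<open>The supremum is bounded below by the value at the exact solution \<open>0\<close>.\<close>
  have sup: "((\<lambda>(\<delta>, \<rho>). SUP x \<in> log_source_set \<sigma> v p \<rho>. P \<delta> \<rho> x) \<longlongrightarrow> 1) noise_ratio_to_0"
  proof -
    define \<mu> where "\<mu> = distr M borel (\<lambda>\<omega>. norm (spectral_cutoff \<sigma> u v (\<lambda>y. Z y \<omega>) (k_dp \<tau> 1 u (\<lambda>y. Z y \<omega>))))"
    have "real_distribution \<mu>" unfolding \<mu>_def
      using dp_error_measurable[OF onv, of "\<lambda>\<omega> y. Z y \<omega>" u M \<sigma> \<tau> 1 0] Zm
      by (intro real_distribution_distr) simp
    then interpret \<mu>: real_distribution \<mu> .
    define B where "B = (\<lambda>s. exp (s / 2) * s powr (- p / 2))"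
    have "filterlim B at_top at_top" unfolding B_def using p by real_asymp
    from filterlim_compose[OF this S]
    have "filterlim (\<lambda>z. B (S z) * sqrt (relative_risk a p \<tau> (S z))) at_top noise_ratio_to_0"
      by (rule filterlim_at_top_mult_tendsto_pos[OF risk, rotated]) simp
    then have lim: "((\<lambda>z. cdf \<mu> (B (S z) * sqrt (relative_risk a p \<tau> (S z)))) \<longlongrightarrow> 1) noise_ratio_to_0"
      by (rule filterlim_compose[OF \<mu>.cdf_lim_at_top_prob])
    show ?thesis
    proof (rule tendsto_sandwich[OF _ _ lim tendsto_const])
      show "\<forall>\<^sub>F z in noise_ratio_to_0. cdf \<mu> (B (S z) * sqrt (relative_risk a p \<tau> (S z)))
          \<le> (case z of (\<delta>, \<rho>) \<Rightarrow> SUP x \<in> log_source_set \<sigma> v p \<rho>. P \<delta> \<rho> x)"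
        using eventually_noise_ratio_pos
      proof eventually_elim
        case (elim z)
        obtain \<delta> \<rho> where z: "z = (\<delta>, \<rho>)" by (cases z)
        with elim have pos: "\<delta> > 0" "\<rho> > 0" by auto
        have "exp (S z / 2) = \<rho> / \<delta>"
        proof -
          have "S z = 2 * ln (\<rho> / \<delta>)"
            using pos by (simp add: z S_def ln_div ln_realpow)
          then show ?thesis using pos by simp
        qed
        then have "P \<delta> \<rho> 0 = cdf \<mu> (B (S z) * sqrt (relative_risk a p \<tau> (S z)))"
          unfolding P_def \<mu>_def zero_solution_success_prob[where K=K and Z=Z, OF K.zero pos(1) onv Zm]
          by (simp add: B_def \<epsilon>_def z S_def)
        then show ?case using cSUP_upper[OF ne[OF pos(2)] bdd(1)[of \<delta> \<rho>]] by (simp add: z)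
      qed
      show "\<forall>\<^sub>F z in noise_ratio_to_0. (case z of (\<delta>, \<rho>) \<Rightarrow> SUP x \<in> log_source_set \<sigma> v p \<rho>. P \<delta> \<rho> x) \<le> 1"
        using eventually_noise_ratio_pos
      proof eventually_elim
        case (elim z)
        then obtain \<delta> \<rho> where z: "z = (\<delta>, \<rho>)" "\<rho> > 0" by (cases z) auto
        have "(SUP x \<in> log_source_set \<sigma> v p \<rho>. P \<delta> \<rho> x) \<le> 1"
          by (rule cSUP_least) (use ne[OF z(2)] P01(2) in blast)+
        then show ?case by (simp add: z(1))
      qed
    qed
  qed
  have inf: "((\<lambda>(\<delta>, \<rho>). INF x \<in> log_source_set \<sigma> v p \<rho>. P \<delta> \<rho> x) \<longlongrightarrow> 1) noise_ratio_to_0"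
    if iid: "iid_coefficients M Z u"
  proof -
    define \<theta> where "\<theta> = (1 + \<tau>) / 2"
    have \<theta>: "1 < \<theta>" "\<theta> < \<tau>" using assms(8) by (auto simp: \<theta>_def)
    define Q where "Q n = prob {\<omega> \<in> space M. \<forall>m\<ge>n. (\<Sum>j=1..m. (Z (u j) \<omega>)\<^sup>2) \<le> \<theta>\<^sup>2 * real m}" for n
    have "Q \<longlonglongrightarrow> 1"
      unfolding Q_def
    proof (rule iid_noise_tail_bound)
      show "indep_vars (\<lambda>_. borel) (\<lambda>j. Z (u j)) {1..}"
        using iid unfolding iid_coefficients_def by blast
      show "distr M borel (Z (u j)) = distr M borel (Z (u 1))" if "j \<ge> 1" for j
        using iid that unfolding iid_coefficients_def by blast
      show "integrable M (\<lambda>\<omega>. (Z (u 1) \<omega>)\<^sup>2)" by (rule Zi)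
      show "expectation (\<lambda>\<omega>. (Z (u 1) \<omega>)\<^sup>2) = 1" unfolding ZE using onu by simp
      show "1 < \<theta>\<^sup>2" using \<theta>(1) by (rule one_less_power) simp
    qed
    then have "((\<lambda>s. Q (level a (p + 2) s)) \<longlongrightarrow> 1) at_top"
      by (rule filterlim_compose) (rule filterlim_level[OF a])
    moreover have "((\<lambda>s::real. s powr (- 1/4) / (1 - exp (- a))) \<longlongrightarrow> 0) at_top"
    proof -
      have "((\<lambda>s::real. s powr (- 1/4)) \<longlongrightarrow> 0) at_top" by real_asymp
      from tendsto_divide[OF this tendsto_const[of "1 - exp (- a)"]] a show ?thesis by simp
    qed
    ultimately have "((\<lambda>s. Q (level a (p + 2) s) - s powr (- 1/4) / (1 - exp (- a))) \<longlongrightarrow> 1 - 0) at_top"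
      by (rule tendsto_diff)
    from filterlim_compose[OF this S]
    have lim: "((\<lambda>z. Q (level a (p + 2) (S z)) - S z powr (- 1/4) / (1 - exp (- a))) \<longlongrightarrow> 1) noise_ratio_to_0"
      by simp
    have large: "\<forall>\<^sub>F z in noise_ratio_to_0. R (S z)" if "eventually R at_top" for R
      using S that by (rule filterlim_iff[THEN iffD1, rule_format])
    show ?thesis
    proof (rule tendsto_sandwich[OF _ _ lim tendsto_const])
      have c: "(\<tau> - \<theta>)\<^sup>2 > 0" using \<theta> by simp
      show "\<forall>\<^sub>F z in noise_ratio_to_0. Q (level a (p + 2) (S z)) - S z powr (- 1/4) / (1 - exp (- a))
          \<le> (case z of (\<delta>, \<rho>) \<Rightarrow> INF x \<in> log_source_set \<sigma> v p \<rho>. P \<delta> \<rho> x)"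
        using eventually_noise_ratio_pos large[OF eventually_ge_at_top[of 1]]
          large[OF eventually_log_le[of "p + 1/2"]] large[OF level_ge_1[OF a, of "p + 2"]]
          large[OF level_signal_small[OF a p c]]
      proof eventually_elim
        case (elim z)
        obtain \<delta> \<rho> where z: "z = (\<delta>, \<rho>)" by (cases z)
        with elim(1) have pos: "\<delta> > 0" "\<rho> > 0" by auto
        have Sz: "- ln (\<delta>\<^sup>2 / \<rho>\<^sup>2) = S z" by (simp add: z S_def)
        have "Q (level a (p + 2) (S z)) - S z powr (- 1/4) / (1 - exp (- a)) \<le> P \<delta> \<rho> x"
          if "x \<in> log_source_set \<sigma> v p \<rho>" for x
          using dp_success_prob_lower_bound[OF \<open>prob_space M\<close> K svd wn a \<sigma> p _ \<theta>(2) pos that] elim \<theta>(1)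
          unfolding Sz P_def Q_def by (simp add: \<epsilon>_def z)
        then show ?case using ne[OF pos(2)] by (auto simp: z intro!: cINF_greatest)
      qed
      show "\<forall>\<^sub>F z in noise_ratio_to_0. (case z of (\<delta>, \<rho>) \<Rightarrow> INF x \<in> log_source_set \<sigma> v p \<rho>. P \<delta> \<rho> x) \<le> 1"
        using eventually_noise_ratio_pos
      proof eventually_elim
        case (elim z)
        then obtain \<delta> \<rho> where z: "z = (\<delta>, \<rho>)" "\<rho> > 0" by (cases z) auto
        have "(INF x \<in> log_source_set \<sigma> v p \<rho>. P \<delta> \<rho> x) \<le> 1"
          by (rule cINF_lower2[OF bdd(2) ne[OF z(2)] P01(2)])
        then show ?case by (simp add: z(1))
      qed
    qed
  qed
  show ?thesis
    using \<epsilon> sup inf unfolding P_def by blast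
qed

end
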